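(* In the planar setting described in the context, let $c$ be symmetric, let $\lambda:V^\infty\to\mathbb R_{>0}$ be massive harmonic on $V$, i.e. $(\Delta^{\mathrm k}\lambda)(x)=0$ for all $x\in V$, and let $\lambda^\star:V^\star\to\mathbb R_{>0}$ be arbitrary. Let $K^{\mathrm d}$ and $K^{\mathrm k}$ be the Kasteleyn matrices of the drifted and killed dimer models on the double graph $\underline G^{D}$. Then: (i) if $G$ is finite, $Z_{\mathrm{RSF}}(G,c,m)=Z_{\mathrm{dim}}(\underline G^{D},\nu^{\mathrm d})$; (ii) the drifted and killed dimer models are gauge equivalent: there are diagonal matrices $\Phi$ (indexed by $W$) and $\Psi$ (indexed by $\underline B$) with positive diagonal entries such that $K^{\mathrm k}=\Phi K^{\mathrm d}\Psi$; (iii) there is a matrix $\widetilde\Delta^\star$ with rows and columns indexed by $\underline V^\star$ such that, with respect to the decomposition $\underline B=V\sqcup\underline V^\star$, $$(K^{\mathrm k})^\dagger K^{\mathrm k}=\begin{pmatrix}\Delta^{\mathrm k}_V&0\\0&\widetilde\Delta^\star\end{pmatrix}.$$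
   Context: Graphs are connected, locally finite, countable; $x\sim y$ means $xy$ is an edge. $(G^\infty,c^\infty,m^\infty)$ is a planar graph $G^\infty=(V^\infty,E^\infty)$ with symmetric positive conductances $c^\infty_{xy}$ and masses $m^\infty\ge0$; its massive Laplacian is $(\Delta^{\mathrm k}f)(x)=m^\infty(x)f(x)+\sum_{y\sim x}c^\infty_{xy}(f(x)-f(y))$. Two cases. Infinite case: $V=V^\infty$ is infinite, $G=G^\infty$, $c=c^\infty$, $m=m^\infty$. Finite case: $V\subsetneq V^\infty$ is finite, its induced subgraph $G=(V,E)$ is connected and simply connected (all vertices of $V^\infty\setminus V$ lie in the outer face of $G$), $c$ is the restriction of $c^\infty$ and $m(x)=m^\infty(x)+\sum_{y\sim x,\,y\in V^\infty\setminus V}c^\infty_{xy}$. $\Delta^{\mathrm k}_V$ is the restriction of the matrix $\Delta^{\mathrm k}$ to $V\times V$ (it is the massive Laplacian of $(G,c,m)$). $G^o$: in the infinite case $G^o=G$. In the finite case $G^o$ is the planar multigraph obtained from $G$ by adding a vertex $o$ in the outer face and, for each edge $xz$ of $G^\infty$ with $x\in V$, $z\notin V$, an edge joining $x$ to $o$; for such an edge $xy$ with $y=o$, we write $c_{xy}=c^\infty_{xz}$ and $\lambda(y)=\lambda(z)$. $G^\star=(V^\star,E^\star)$ is the dual graph of $G^o$ (in the finite case $G^o$ is viewed on the sphere with $o$ at infinity, so $V^\star$ is the set of all faces of $G^o$); each dual edge crosses exactly one edge of $G^o$. In the finite case fix $r\in V^\star$ a face of $G^o$ incident to $o$, and let $\underline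 V^\star=V^\star\setminus\{r\}$; in the infinite case $\underline V^\star=V^\star$. Double graph $\underline G^{D}$: bipartite, with white vertices $W$ = crossings of an edge of $G^o$ with its dual edge, and black vertices $\underline B=V\sqcup\underline V^\star$. If $w$ is the crossing of $xy$ and the dual edge $uv$, $w$ is joined to those of $x,y,u,v$ that belong to $\underline B$. Dimer configurations of $\underline G^D$ are sets of edges covering each vertex exactly once; for an edge weight $\nu>0$, $Z_{\mathrm{dim}}(\underline G^D,\nu)=\sum_{\mathsf M}\prod_{e\in\mathsf M}\nu_e$. Phases: for each $w$, with neighbours (in the double graph before removal of $o,r$) $x,u,y,v$ in clockwise order ($x,y$ primal, $u,v$ dual), $\zeta_{wx}=1,\zeta_{wu}=i,\zeta_{wy}=-1,\zeta_{wv}=-i$ (the choice between $x$ and $y$ is arbitrary for each $w$, but fixed). The Kasteleyn matrix of $\nu$ has entries $K_{w,b}=\zeta_{wb}\nu_{wb}$ if $w\sim b$ (summed over edges joining $w$ and $b$ in case of multiplicity) and $0$ otherwise, $w\in W$, $b\in\underline B$. $M^\dagger$ is the conjugate transpose. Drifted dimer model: $\nu^{\mathrm d}_{wu}=1$ for dual $u$, and $\nu^{\mathrm d}_{wx}=c_{xy}\lambda(y)/\lambda(x)$ for primal $x\in V$, where $w$ lies on the edge $xy$ of $G^o$. Killed dimer model: $\nu^{\mathrm k}_{wu}=\lambda^\star(u)^{-1}(c_{xy}\lambda(x)\lambda(y))^{-1/2}$ and $\nu^{\mathrm k}_{wx}=\big(c_{xy}\lambda(y)/\lambda(x)\big)^{1/2}$.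 A rooted spanning forest $F$ of a finite graph $G$ is a set of directed edges with no cycle such that each vertex has at most one outgoing edge in $F$; $R(F)$ is the set of vertices with no outgoing edge; $Z_{\mathrm{RSF}}(G,c,m)=\sum_F\prod_{\vec e\in F}c_{\vec e}\prod_{x\in R(F)}m(x)$. *)

theory Defs
  imports "HOL-Analysis.Analysis" "HOL-Combinatorics.Orbits"
begin

text \<open>
  Plane graphs are given by rotation systems (combinatorial maps).  The graph is simple, so an
  oriented edge (dart) is an ordered pair of adjacent vertices, and the adjacency relation, a
  symmetric and irreflexive set of pairs, is the set of all darts.  The drawing is recorded by the
  permutation \<open>rot\<close> of the darts that sends a dart \<open>(x,y)\<close> to the next dart out of \<open>x\<close> in clockwise
  order.  Then \<open>face_perm rot (x,y)\<close> is the dart that follows \<open>(x,y)\<close> along the boundary of the face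
  on its left, and a face is the set of all darts that have this face on their left.
\<close>

type_synonym 'v dart = "'v \<times> 'v"
type_synonym 'v face = "'v dart set"

definition out_darts :: "'v dart set \<Rightarrow> 'v \<Rightarrow> 'v dart set" where
  "out_darts D x = {d \<in> D. fst d = x}"

definition nbrs :: "'v dart set \<Rightarrow> 'v \<Rightarrow> 'v set" where
  "nbrs D x = {y. (x, y) \<in> D}"

definition uedge :: "'v dart \<Rightarrow> 'v set" where
  "uedge d = {fst d, snd d}"

definition face_perm :: "('v dart \<Rightarrow> 'v dart) \<Rightarrow> 'v dart \<Rightarrow> 'v dart" where
  "face_perm rot d = rot (prod.swap d)"

text \<open>Boundary walks of faces may be infinite; hence iteration in both directions.\<close>

definition left_face :: "'v dart set \<Rightarrow> ('v dart \<Rightarrow> 'v dart) \<Rightarrow> 'v dart \<Rightarrow> 'v face" where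
  "left_face D rot d =
     {d' \<in> D. \<exists>n. (face_perm rot ^^ n) d = d' \<or> (face_perm rot ^^ n) d' = d}"

definition faces :: "'v dart set \<Rightarrow> ('v dart \<Rightarrow> 'v dart) \<Rightarrow> 'v face set" where
  "faces D rot = left_face D rot ` D"

definition connected_graph :: "'v set \<Rightarrow> 'v dart set \<Rightarrow> bool" where
  "connected_graph U D \<longleftrightarrow> U \<noteq> {} \<and> (\<forall>x\<in>U. \<forall>y\<in>U. (x, y) \<in> D\<^sup>*)"

text \<open>Genus zero, for a finite connected map with \<open>n\<close> vertices and at least one edge.\<close>

definition genus_zero :: "nat \<Rightarrow> 'v dart set \<Rightarrow> ('v dart \<Rightarrow> 'v dart) \<Rightarrow> bool" where
  "genus_zero n D rot \<longleftrightarrow> n + card (faces D rot) = card (uedge ` D) + 2"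

text \<open>
  The first of \<open>f d\<close>, \<open>f (f d)\<close>, ... that lies in \<open>A\<close>.  For \<open>D' \<subseteq> D\<close>, \<open>next_in rot D'\<close> is the clockwise
  rotation of the drawing of the subgraph with darts \<open>D'\<close>.
\<close>

definition next_in :: "('a \<Rightarrow> 'a) \<Rightarrow> 'a set \<Rightarrow> 'a \<Rightarrow> 'a" where
  "next_in f A d = (f ^^ (LEAST n. 1 \<le> n \<and> (f ^^ n) d \<in> A)) d"

definition induced :: "'v dart set \<Rightarrow> 'v set \<Rightarrow> 'v dart set" where
  "induced E U = E \<inter> U \<times> U"

text \<open>
  Connected, locally finite, countable plane graph.  A possibly infinite rotation system is planar
  if all its finite connected induced submaps have genus zero.
\<close>

definition plane_graph :: "'v set \<Rightarrow> 'v dart set \<Rightarrow> ('v dart \<Rightarrow> 'v dart) \<Rightarrow> bool" where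
  "plane_graph VI E rot \<longleftrightarrow>
     countable VI \<and> E \<subseteq> VI \<times> VI \<and> sym E \<and> irrefl E \<and> connected_graph VI E \<and>
     (\<forall>x\<in>VI. finite (out_darts E x) \<and> cyclic_on rot (out_darts E x)) \<and>
     (\<forall>U\<subseteq>VI. finite U \<and> 2 \<le> card U \<and> connected_graph U (induced E U) \<longrightarrow>
        genus_zero (card U) (induced E U) (next_in rot (induced E U)))"

text \<open>
  The vertex \<open>z \<notin> V\<close> lies in the face \<open>F\<close> of the induced subgraph on \<open>V\<close>: it is joined, by a path
  avoiding \<open>V\<close>, to an edge that leaves \<open>V\<close> in a corner of \<open>F\<close>.  (If an edge lies in a corner at \<open>x\<close>,
  then the next edge of the subgraph in clockwise order has the face of that corner on its left.)
\<close>

definition lies_in_face ::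
  "'v dart set \<Rightarrow> ('v dart \<Rightarrow> 'v dart) \<Rightarrow> 'v set \<Rightarrow> 'v \<Rightarrow> 'v face \<Rightarrow> bool" where
  "lies_in_face E rot V z F \<longleftrightarrow>
     (\<exists>x z'. x \<in> V \<and> (z, z') \<in> (induced E (- V))\<^sup>* \<and> (x, z') \<in> E \<and> z' \<notin> V \<and>
        next_in rot (induced E V) (x, z') \<in> F)"

text \<open>
  All vertices outside \<open>V\<close> lie in one face, the outer face of the induced subgraph on \<open>V\<close>.  A graph
  with a single vertex has a single face, which contains no dart.
\<close>

definition outside_in_outer_face ::
  "'v set \<Rightarrow> 'v dart set \<Rightarrow> ('v dart \<Rightarrow> 'v dart) \<Rightarrow> 'v set \<Rightarrow> bool" where
  "outside_in_outer_face VI E rot V \<longleftrightarrow>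
     card V = 1 \<or>
     (\<exists>F \<in> faces (induced E V) (next_in rot (induced E V)). \<forall>z \<in> VI - V. lies_in_face E rot V z F)"

definition finite_case ::
  "'v set \<Rightarrow> 'v dart set \<Rightarrow> ('v dart \<Rightarrow> 'v dart) \<Rightarrow> 'v set \<Rightarrow> bool" where
  "finite_case VI E rot V \<longleftrightarrow>
     finite V \<and> V \<subset> VI \<and> connected_graph V (induced E V) \<and> outside_in_outer_face VI E rot V"

definition infinite_case :: "'v set \<Rightarrow> 'v set \<Rightarrow> bool" where
  "infinite_case VI V \<longleftrightarrow> infinite V \<and> V = VI"

text \<open>
  The graph \<open>G\<^sup>o\<close>: its edges are the edges of the ambient graph with at least one endpoint in \<open>V\<close>, and
  every endpoint outside \<open>V\<close> is regarded as the vertex \<open>o\<close>.  Thus \<open>(x,z)\<close> with \<open>x \<in> V\<close>, \<open>z \<notin> V\<close> is a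
  dart from \<open>x\<close> to \<open>o\<close>, parallel edges to \<open>o\<close> stay distinct, and \<open>c\<close> and \<open>\<lambda>\<close> need no adjustment.
\<close>

definition Go_darts :: "'v dart set \<Rightarrow> 'v set \<Rightarrow> 'v dart set" where
  "Go_darts E V = {d \<in> E. fst d \<in> V \<or> snd d \<in> V}"

text \<open>
  \<open>roto\<close> is the clockwise rotation of the planar map \<open>G\<^sup>o\<close>: at the vertices of \<open>V\<close> it is that of the
  ambient graph (the edge \<open>xo\<close> replacing \<open>xz\<close> leaves \<open>x\<close> at the place of \<open>xz\<close>), and the cyclic order
  at \<open>o\<close> is the one for which \<open>G\<^sup>o\<close> is drawn on the sphere.
\<close>

definition Go_rotation ::
  "'v dart set \<Rightarrow> ('v dart \<Rightarrow> 'v dart) \<Rightarrow> 'v set \<Rightarrow> ('v dart \<Rightarrow> 'v dart) \<Rightarrow> bool" where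
  "Go_rotation E rot V roto \<longleftrightarrow>
     (\<forall>d \<in> Go_darts E V. fst d \<in> V \<longrightarrow> roto d = rot d) \<and>
     (finite V \<longrightarrow>
        cyclic_on roto {d \<in> Go_darts E V. fst d \<notin> V} \<and>
        genus_zero (card V + 1) (Go_darts E V) roto)"

definition Vstar :: "'v dart set \<Rightarrow> 'v set \<Rightarrow> ('v dart \<Rightarrow> 'v dart) \<Rightarrow> 'v face set" where
  "Vstar E V roto = faces (Go_darts E V) roto"

definition Vstar_red ::
  "'v dart set \<Rightarrow> 'v set \<Rightarrow> ('v dart \<Rightarrow> 'v dart) \<Rightarrow> 'v face \<Rightarrow> 'v face set" where
  "Vstar_red E V roto r = Vstar E V roto - (if finite V then {r} else {})"

definition incident_o :: "'v set \<Rightarrow> 'v face \<Rightarrow> bool" where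
  "incident_o V f \<longleftrightarrow> (\<exists>d\<in>f. fst d \<notin> V)"

text \<open>
  The double graph.  The white vertex on an edge of \<open>G\<^sup>o\<close> is represented by that edge.  At the white
  vertex on \<open>xy\<close> there are up to four edges: \<open>Primal (x,y)\<close> to \<open>x\<close>, \<open>Primal (y,x)\<close> to \<open>y\<close>,
  \<open>Dual (x,y)\<close> to the face on the left of \<open>(x,y)\<close> and \<open>Dual (y,x)\<close> to the face on its right.  The two
  dual edges are parallel if the two faces coincide.
\<close>

datatype 'v dedge = Primal "'v dart" | Dual "'v dart"

definition whites :: "'v dart set \<Rightarrow> 'v set \<Rightarrow> 'v set set" where
  "whites E V = uedge ` Go_darts E V"

definition blacks ::
  "'v dart set \<Rightarrow> 'v set \<Rightarrow> ('v dart \<Rightarrow> 'v dart) \<Rightarrow> 'v face \<Rightarrow> ('v + 'v face) set" where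
  "blacks E V roto r = V <+> Vstar_red E V roto r"

primrec white_end :: "'v dedge \<Rightarrow> 'v set" where
  "white_end (Primal d) = uedge d"
| "white_end (Dual d) = uedge d"

primrec black_end ::
  "'v dart set \<Rightarrow> 'v set \<Rightarrow> ('v dart \<Rightarrow> 'v dart) \<Rightarrow> 'v dedge \<Rightarrow> 'v + 'v face" where
  "black_end E V roto (Primal d) = Inl (fst d)"
| "black_end E V roto (Dual d) = Inr (left_face (Go_darts E V) roto d)"

definition dedges ::
  "'v dart set \<Rightarrow> 'v set \<Rightarrow> ('v dart \<Rightarrow> 'v dart) \<Rightarrow> 'v face \<Rightarrow> 'v dedge set" where
  "dedges E V roto r =
     {e \<in> Primal ` Go_darts E V \<union> Dual ` Go_darts E V. black_end E V roto e \<in> blacks E V roto r}"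

definition dimer_configs ::
  "'v dart set \<Rightarrow> 'v set \<Rightarrow> ('v dart \<Rightarrow> 'v dart) \<Rightarrow> 'v face \<Rightarrow> 'v dedge set set" where
  "dimer_configs E V roto r =
     {M. M \<subseteq> dedges E V roto r \<and>
         (\<forall>w \<in> whites E V. \<exists>!e. e \<in> M \<and> white_end e = w) \<and>
         (\<forall>b \<in> blacks E V roto r. \<exists>!e. e \<in> M \<and> black_end E V roto e = b)}"

definition Z_dim ::
  "'v dart set \<Rightarrow> 'v set \<Rightarrow> ('v dart \<Rightarrow> 'v dart) \<Rightarrow> 'v face \<Rightarrow> ('v dedge \<Rightarrow> real) \<Rightarrow> real" where
  "Z_dim E V roto r \<nu> = (\<Sum>M \<in> dimer_configs E V roto r. \<Prod>e\<in>M. \<nu> e)"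

text \<open>
  Phases.  \<open>ori w\<close> is the dart \<open>(x,y)\<close> over the edge \<open>w\<close> that fixes which endpoint is \<open>x\<close>.  In the
  clockwise order \<open>x, u, y, v\<close> around \<open>w\<close>, the face \<open>u\<close> is on the left of \<open>(x,y)\<close>.
\<close>

primrec phase :: "('v set \<Rightarrow> 'v dart) \<Rightarrow> 'v dedge \<Rightarrow> complex" where
  "phase ori (Primal d) = (if d = ori (uedge d) then 1 else - 1)"
| "phase ori (Dual d) = (if d = ori (uedge d) then \<i> else - \<i>)"

definition Kasteleyn ::
  "'v dart set \<Rightarrow> 'v set \<Rightarrow> ('v dart \<Rightarrow> 'v dart) \<Rightarrow> 'v face \<Rightarrow> ('v set \<Rightarrow> 'v dart) \<Rightarrow>
     ('v dedge \<Rightarrow> real) \<Rightarrow> 'v set \<Rightarrow> 'v + 'v face \<Rightarrow> complex" where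
  "Kasteleyn E V roto r ori \<nu> w b =
     (\<Sum>e \<in> {e \<in> dedges E V roto r. white_end e = w \<and> black_end E V roto e = b}.
        phase ori e * complex_of_real (\<nu> e))"

primrec drifted_weight :: "('v \<Rightarrow> 'v \<Rightarrow> real) \<Rightarrow> ('v \<Rightarrow> real) \<Rightarrow> 'v dedge \<Rightarrow> real" where
  "drifted_weight c lam (Primal d) = c (fst d) (snd d) * lam (snd d) / lam (fst d)"
| "drifted_weight c lam (Dual d) = 1"

primrec killed_weight ::
  "'v dart set \<Rightarrow> 'v set \<Rightarrow> ('v dart \<Rightarrow> 'v dart) \<Rightarrow> ('v \<Rightarrow> 'v \<Rightarrow> real) \<Rightarrow> ('v \<Rightarrow> real) \<Rightarrow>
     ('v face \<Rightarrow> real) \<Rightarrow> 'v dedge \<Rightarrow> real" where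
  "killed_weight E V roto c lam lams (Primal d) =
     (c (fst d) (snd d) * lam (snd d) / lam (fst d)) powr (1/2)"
| "killed_weight E V roto c lam lams (Dual d) =
     inverse (lams (left_face (Go_darts E V) roto d)) *
     (c (fst d) (snd d) * lam (fst d) * lam (snd d)) powr (- 1/2)"

definition massive_laplacian ::
  "'v dart set \<Rightarrow> ('v \<Rightarrow> 'v \<Rightarrow> real) \<Rightarrow> ('v \<Rightarrow> real) \<Rightarrow> ('v \<Rightarrow> real) \<Rightarrow> 'v \<Rightarrow> real" where
  "massive_laplacian E c m f x = m x * f x + (\<Sum>y \<in> nbrs E x. c x y * (f x - f y))"

definition laplacian_matrix ::
  "'v dart set \<Rightarrow> ('v \<Rightarrow> 'v \<Rightarrow> real) \<Rightarrow> ('v \<Rightarrow> real) \<Rightarrow> 'v \<Rightarrow> 'v \<Rightarrow> real" where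
  "laplacian_matrix E c m x y = massive_laplacian E c m (\<lambda>z. if z = y then 1 else 0) x"

definition mass_G ::
  "'v dart set \<Rightarrow> 'v set \<Rightarrow> ('v \<Rightarrow> 'v \<Rightarrow> real) \<Rightarrow> ('v \<Rightarrow> real) \<Rightarrow> 'v \<Rightarrow> real" where
  "mass_G E V c mI x = mI x + (\<Sum>y \<in> nbrs E x - V. c x y)"

definition rooted_forests :: "'v dart set \<Rightarrow> 'v dart set set" where
  "rooted_forests D = {F. F \<subseteq> D \<and> acyclic F \<and> single_valued F}"

definition Z_RSF ::
  "'v set \<Rightarrow> 'v dart set \<Rightarrow> ('v \<Rightarrow> 'v \<Rightarrow> real) \<Rightarrow> ('v \<Rightarrow> real) \<Rightarrow> real" where
  "Z_RSF V D c m =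
     (\<Sum>F \<in> rooted_forests D. (\<Prod>d\<in>F. c (fst d) (snd d)) * (\<Prod>x \<in> V - Domain F. m x))"

text \<open>
  Entry \<open>(b, b')\<close> of \<open>K\<^sup>\<dagger> K\<close> for a matrix with rows indexed by \<open>W\<close>.  If \<open>b\<close> or \<open>b'\<close> is a primal
  vertex (or a face of finite degree), only finitely many terms are nonzero.
\<close>

definition gram :: "'w set \<Rightarrow> ('w \<Rightarrow> 'b \<Rightarrow> complex) \<Rightarrow> 'b \<Rightarrow> 'b \<Rightarrow> complex" where
  "gram W K b b' = (\<Sum>\<^sub>\<infinity>w\<in>W. cnj (K w b) * K w b')"

fun block_diag ::
  "('p \<Rightarrow> 'p \<Rightarrow> complex) \<Rightarrow> ('q \<Rightarrow> 'q \<Rightarrow> complex) \<Rightarrow> 'p + 'q \<Rightarrow> 'p + 'q \<Rightarrow> complex" where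
  "block_diag A B (Inl x) (Inl y) = A x y"
| "block_diag A B (Inr u) (Inr v) = B u v"
| "block_diag A B _ _ = 0"

end

theory Submission
  imports Defs "Jordan_Normal_Form.Determinant"
begin

text \<open>
  Both partition functions in (i) are determinants: by the matrix-tree theorem the forests of \<open>G\<close>
  are counted by the massive Laplacian, and the spanning trees of \<open>G\<^sup>o\<close> with root \<open>o\<close> and drifted
  conductances by the drifted Laplacian, which is its conjugate by \<open>\<lambda>\<close> because \<open>\<lambda>\<close> is massive
  harmonic.  Temperley's bijection identifies these trees with the dimer configurations.  Its
  delicate point is that the primal half of a dimer configuration contains no cycle.  Such a cycle
  would enclose a dual cycle of the dual half, because no enclosed face is the root; this dual cycle
  would in turn enclose another primal cycle, and so on, each enclosing strictly fewer faces than
  the previous one.  Enclosure is expressed by winding numbers: in genus zero a cycle, seen as a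
  divergence-free flow, is the boundary of a function on the faces.
\<close>

subsection \<open>Weighted matrix-tree theorem\<close>

text \<open>Harmonicity of \<open>lam\<close> matches the two models of (i) only in total: it is a
  sum over all edges at a vertex, whereas the weight of one drifted tree contains quotients of
  \<open>lam\<close> that no single forest reproduces. This is why that comparison passes through
  determinants, while Temperley's bijection preserves each weight. The inside of a cycle needs no
  curve in the plane: it is the set where a potential, found by counting dimensions, does not
  vanish. Statements (ii) and (iii) are local and hold for infinite \<open>V\<close> by the same
  computation: the gauge is read off the dual edges, where the drifted weight is 1; in the Gram
  matrix the diagonal of the primal block is harmonicity once more, and the mixed blocks vanish
  because the rotation permutes the edges at a vertex.\<close>

definition forest_sum :: "'v set \<Rightarrow> ('v \<Rightarrow> 'v set) \<Rightarrow> ('v \<Rightarrow> 'v \<Rightarrow> real) \<Rightarrow> real" where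
  "forest_sum V N w = (\<Sum>f | f \<in> PiE V N \<and> acyclic ((\<lambda>x. (x, f x)) ` V). \<Prod>x\<in>V. w x (f x))"

text \<open>The matrix is the identity minus the transition matrix of \<open>f\<close> killed
  outside \<open>V\<close>. A permutation other than the identity with nonzero product must follow
  \<open>f\<close> on every point that it moves, so \<open>f\<close> would have a cycle there.
  Conversely, a cycle of \<open>f\<close> yields a kernel vector.\<close>

lemma det_step_matrix:
  fixes f :: "'v \<Rightarrow> 'v"
  assumes bij: "bij_betw v {0..<n} V"
  shows "Determinant.det (Matrix.mat n n (\<lambda>(i, j). of_bool (v i = v j) - of_bool (f (v i) = v j)))
    = (of_bool (acyclic ((\<lambda>x. (x, f x)) ` V)) :: real)"
    (is "Determinant.det ?A = of_bool (acyclic ?F)")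
proof (cases "acyclic ?F")
  case True
  have inj: "inj_on v {0..<n}" and V: "V = v ` {0..<n}" using bij by (auto simp: bij_betw_def)
  have "finite ?F" using V by auto
  then have wf: "wf (?F\<inverse>)" using True finite_acyclic_wf_converse by blast
  have zero: "(\<Prod>i = 0..<n. ?A $$ (i, p i)) = 0" if p: "p permutes {0..<n}" "p \<noteq> id" for p
  proof (rule ccontr)
    assume np: "(\<Prod>i = 0..<n. ?A $$ (i, p i)) \<noteq> 0"
    have nz: "of_bool (v i = v (p i)) - of_bool (f (v i) = v (p i)) \<noteq> (0 :: real)" if "i < n" for i
    proof -
      have "p i < n" using p that permutes_in_image[of p "{0..<n}" i] by simp
      moreover have "?A $$ (i, p i) \<noteq> 0"
        using np prod_zero[of "{0..<n}" "\<lambda>i. ?A $$ (i, p i)"] that by (meson atLeastLessThan_iff finite_atLeastLessThan zero_le)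
      ultimately show ?thesis using that by simp
    qed
    have step: "v (p i) = f (v i)" if "i < n" "p i \<noteq> i" for i
    proof -
      have "p i < n" using p(1) that permutes_in_image[of p "{0..<n}" i] by simp
      then have "v i \<noteq> v (p i)" using inj_onD[OF inj, of i "p i"] that by auto
      then show ?thesis using nz[OF that(1)] by (auto simp: of_bool_def split: if_splits)
    qed
    define X where "X = v ` {i. i < n \<and> p i \<noteq> i}"
    have "X \<noteq> {}" using p unfolding X_def by (auto simp: fun_eq_iff permutes_def)
    then obtain x where x: "x \<in> X" and xmin: "\<And>y. (x, y) \<in> ?F \<Longrightarrow> y \<notin> X"
      using wf unfolding wf_eq_minimal by (metis converse_iff ex_in_conv)
    then obtain i where i: "i < n" "p i \<noteq> i" "x = v i" unfolding X_def by auto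
    have "p i < n" using p i permutes_in_image[of p "{0..<n}" i] by simp
    moreover have "p (p i) \<noteq> p i" using i p by (metis permutes_inj injD)
    ultimately have "v (p i) \<in> X" unfolding X_def by auto
    moreover have "(x, v (p i)) \<in> ?F" using step[OF i(1,2)] i V by auto
    ultimately show False using xmin by blast
  qed
  have irr: "f (v i) \<noteq> v i" if "i < n" for i
  proof
    assume "f (v i) = v i"
    then have "(v i, v i) \<in> ?F" using that V by (auto simp: image_iff)
    then show False using True unfolding acyclic_def by blast
  qed
  have "Determinant.det ?A = (\<Sum>p | p permutes {0..<n}. signof p * (\<Prod>i = 0..<n. ?A $$ (i, p i)))"
    by (rule det_def') simp
  also have "\<dots> = (\<Sum>p\<in>{id}. signof p * (\<Prod>i = 0..<n. ?A $$ (i, p i)))"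
  proof (rule sum.mono_neutral_right)
    show "\<forall>p\<in>{p. p permutes {0..<n}} - {id}. signof p * (\<Prod>i = 0..<n. ?A $$ (i, p i)) = 0"
      using zero by (metis (no_types, lifting) Diff_iff mem_Collect_eq mult_zero_right singletonI)
  qed (auto simp: finite_permutations permutes_id)
  also have "\<dots> = 1" using irr by (simp add: sign_id)
  finally show ?thesis using True by simp
next
  case False
  have inj: "inj_on v {0..<n}" and V: "V = v ` {0..<n}" using bij by (auto simp: bij_betw_def)
  obtain y where y: "(y, y) \<in> ?F\<^sup>+" using False unfolding acyclic_def by auto
  \<comment> \<open>The points leading to the cycle point \<open>y\<close>. A point lies in
    \<open>X\<close> exactly when its image under \<open>f\<close> does, so the indicator of
    \<open>X\<close> is annihilated.\<close>
  define X where "X = {x. (x, y) \<in> ?F\<^sup>*}"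
  have FX: "f x \<in> X \<longleftrightarrow> x \<in> X" if "x \<in> V" for x
  proof
    assume "f x \<in> X" then show "x \<in> X" using that unfolding X_def by (auto intro: converse_rtrancl_into_rtrancl)
  next
    assume "x \<in> X"
    then have "(x, y) \<in> ?F\<^sup>+" using y unfolding X_def by (auto simp: rtrancl_eq_or_trancl)
    then obtain z where "(x, z) \<in> ?F" "(z, y) \<in> ?F\<^sup>*" by (auto dest: tranclD)
    then show "f x \<in> X" unfolding X_def by auto
  qed
  have yV: "y \<in> V" using y by (auto dest: tranclD)
  define u where "u = Matrix.vec n (\<lambda>i. of_bool (v i \<in> X) :: real)"
  have "u \<noteq> 0\<^sub>v n"
  proof
    assume u: "u = 0\<^sub>v n"
    obtain i where "i < n" "v i = y" using yV V by auto
    then have "vec_index u i = 1" unfolding u_def X_def by simp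
    then show False using u \<open>i < n\<close> by simp
  qed
  moreover have "?A *\<^sub>v u = 0\<^sub>v n"
  proof (rule eq_vecI)
    fix i assume "i < dim_vec (0\<^sub>v n :: real Matrix.vec)"
    then have i: "i < n" by simp
    have pick: "(\<Sum>j = 0..<n. of_bool (z = v j) * of_bool (v j \<in> X)) = (of_bool (z \<in> X \<inter> V) :: real)" for z
    proof -
      have "(\<Sum>j = 0..<n. of_bool (z = v j) * of_bool (v j \<in> X)) = (\<Sum>x\<in>V. of_bool (z = x) * of_bool (x \<in> X) :: real)"
        by (rule sum.reindex_bij_betw[OF bij])
      also have "\<dots> = of_bool (z \<in> X \<inter> V)"
        using V by (simp add: of_bool_def if_distrib[of "\<lambda>z. z * _"] sum.delta cong: if_cong)
      finally show ?thesis .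
    qed
    have XV: "X \<subseteq> V" unfolding X_def using yV by (auto elim: converse_rtranclE)
    have "vec_index (?A *\<^sub>v u) i = of_bool (v i \<in> X \<inter> V) - of_bool (f (v i) \<in> X \<inter> V)"
      using i unfolding pick[symmetric] sum_subtractf[symmetric] left_diff_distrib[symmetric]
      by (simp add: scalar_prod_def u_def)
    then show "vec_index (?A *\<^sub>v u) i = vec_index (0\<^sub>v n) i"
      using FX[of "v i"] V XV i by auto
  qed simp
  moreover have "u \<in> carrier_vec n" unfolding u_def by simp
  ultimately have "Determinant.det ?A = 0" by (subst det_0_iff_vec_prod_zero[of _ n]) auto
  then show ?thesis using False by simp
qed

text \<open>Multilinearity in the rows: the row of \<open>x\<close> is a weighted sum over its
  possible steps, so the determinant splits into one 0-1 determinant for each choice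
  \<open>f\<close> of a step per vertex. Points outside \<open>V\<close> have neither row nor column
  and thereby act as roots.\<close>

lemma forest_sum_eq_det:
  fixes v :: "nat \<Rightarrow> 'v" and w :: "'v \<Rightarrow> 'v \<Rightarrow> real"
  assumes bij: "bij_betw v {0..<n} V" and fin: "\<And>x. x \<in> V \<Longrightarrow> finite (N x)"
  shows "forest_sum V N w = Determinant.det (Matrix.mat n n
    (\<lambda>(i, j). \<Sum>y\<in>N (v i). w (v i) y * (of_bool (v i = v j) - of_bool (y = v j))))"
    (is "_ = Determinant.det ?A")
proof -
  define e where "e = (\<lambda>(x :: 'v) y z. of_bool (x = z) - of_bool (y = z) :: real)"
  have finV: "finite V" using bij bij_betw_finite by blast
  have expand: "(\<Prod>i = 0..<n. ?A $$ (i, p i)) =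
      (\<Sum>f\<in>PiE V N. (\<Prod>x\<in>V. w x (f x)) * (\<Prod>i = 0..<n. e (v i) (f (v i)) (v (p i))))"
    if p: "p permutes {0..<n}" for p
  proof -
    \<comment> \<open>Recovers the index from the vertex, so that the product over rows can be
      rewritten as a product over \<open>V\<close>.\<close>
    define k where "k = the_inv_into {0..<n} v"
    have k: "k (v i) = i" if "i < n" for i
      unfolding k_def by (rule the_inv_into_f_f) (use bij that in \<open>auto simp: bij_betw_def\<close>)
    have "p i < n" if "i < n" for i using p that permutes_in_image[of p "{0..<n}" i] by simp
    then have "(\<Prod>i = 0..<n. ?A $$ (i, p i)) =
        (\<Prod>i = 0..<n. \<Sum>y\<in>N (v i). w (v i) y * e (v i) y (v (p (k (v i)))))"
      by (intro prod.cong) (auto simp: e_def k)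
    also have "\<dots> = (\<Prod>x\<in>V. \<Sum>y\<in>N x. w x y * e x y (v (p (k x))))"
      by (rule prod.reindex_bij_betw[OF bij])
    also have "\<dots> = (\<Sum>f\<in>PiE V N. \<Prod>x\<in>V. w x (f x) * e x (f x) (v (p (k x))))"
      by (rule prod_sum_PiE) (use finV fin in auto)
    also have "\<dots> = (\<Sum>f\<in>PiE V N. (\<Prod>x\<in>V. w x (f x)) * (\<Prod>i = 0..<n. e (v i) (f (v i)) (v (p (k (v i))))))"
    proof (rule sum.cong)
      fix f :: "'v \<Rightarrow> 'v"
      show "(\<Prod>x\<in>V. w x (f x) * e x (f x) (v (p (k x)))) =
          (\<Prod>x\<in>V. w x (f x)) * (\<Prod>i = 0..<n. e (v i) (f (v i)) (v (p (k (v i)))))"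
        using prod.reindex_bij_betw[OF bij, of "\<lambda>x. e x (f x) (v (p (k x)))"]
        by (simp add: prod.distrib)
    qed simp
    finally show ?thesis by (simp add: k)
  qed
  have "Determinant.det ?A = (\<Sum>p | p permutes {0..<n}. signof p * (\<Prod>i = 0..<n. ?A $$ (i, p i)))"
    by (rule det_def') simp
  also have "\<dots> = (\<Sum>p | p permutes {0..<n}. \<Sum>f\<in>PiE V N. signof p *
      ((\<Prod>x\<in>V. w x (f x)) * (\<Prod>i = 0..<n. e (v i) (f (v i)) (v (p i)))))"
    by (intro sum.cong) (simp_all only: expand sum_distrib_left mem_Collect_eq)
  also have "\<dots> = (\<Sum>f\<in>PiE V N. (\<Prod>x\<in>V. w x (f x)) *
      (\<Sum>p | p permutes {0..<n}. signof p * (\<Prod>i = 0..<n. e (v i) (f (v i)) (v (p i)))))"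
    by (subst sum.swap) (simp add: sum_distrib_left mult_ac)
  also have "\<dots> = (\<Sum>f\<in>PiE V N. (\<Prod>x\<in>V. w x (f x)) * of_bool (acyclic ((\<lambda>x. (x, f x)) ` V)))"
  proof (intro sum.cong refl arg_cong[of _ _ "(*) _"])
    fix f
    let ?B = "Matrix.mat n n (\<lambda>(i, j). of_bool (v i = v j) - of_bool (f (v i) = v j)) :: real Matrix.mat"
    have "(\<Sum>p | p permutes {0..<n}. signof p * (\<Prod>i = 0..<n. e (v i) (f (v i)) (v (p i)))) =
        (\<Sum>p | p permutes {0..<n}. signof p * (\<Prod>i = 0..<n. ?B $$ (i, p i)))"
      by (intro sum.cong arg_cong[of _ _ "(*) _"] prod.cong) (auto simp: e_def dest: permutes_in_image)
    also have "\<dots> = Determinant.det ?B" by (rule det_def'[symmetric]) simp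
    also have "\<dots> = of_bool (acyclic ((\<lambda>x. (x, f x)) ` V))" by (rule det_step_matrix[OF bij])
    finally show "(\<Sum>p | p permutes {0..<n}. signof p * (\<Prod>i = 0..<n. e (v i) (f (v i)) (v (p i)))) =
      of_bool (acyclic ((\<lambda>x. (x, f x)) ` V))" .
  qed
  also have "\<dots> = forest_sum V N w"
    unfolding forest_sum_def using finite_PiE[OF finV fin]
    by (simp add: of_bool_def if_distrib[of "(*) _"] sum.If_cases Int_def cong: if_cong)
  finally show ?thesis by simp
qed

text \<open>Conjugation by a diagonal matrix fixes each permutation term of the determinant, since
  the values of \<open>h\<close> above and below run over the same vertices. Only the reduced
  Laplacians are compared, so the sets of possible steps may differ.\<close>

lemma forest_sum_conjugate:
  assumes "finite V" and fin: "\<And>x. x \<in> V \<Longrightarrow> finite (N x)" "\<And>x. x \<in> V \<Longrightarrow> finite (N' x)"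
    and h: "\<And>x. x \<in> V \<Longrightarrow> h x \<noteq> (0 :: real)"
    and conj: "\<And>x z. x \<in> V \<Longrightarrow> z \<in> V \<Longrightarrow>
      (\<Sum>y\<in>N' x. w' x y * (of_bool (x = z) - of_bool (y = z))) =
      (\<Sum>y\<in>N x. w x y * (of_bool (x = z) - of_bool (y = z))) * h z / h x"
  shows "forest_sum V N w = forest_sum V N' w'"
proof -
  obtain v where bij: "bij_betw v {0..<card V} V"
    using ex_bij_betw_nat_finite[OF \<open>finite V\<close>] by blast
  define n where "n = card V"
  note bij = bij[folded n_def]
  have vV: "v i \<in> V" if "i < n" for i using bij that by (auto simp: bij_betw_def)
  let ?A = "Matrix.mat n n (\<lambda>(i, j). \<Sum>y\<in>N (v i). w (v i) y * (of_bool (v i = v j) - of_bool (y = v j)))"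
  let ?B = "Matrix.mat n n (\<lambda>(i, j). \<Sum>y\<in>N' (v i). w' (v i) y * (of_bool (v i = v j) - of_bool (y = v j)))"
  have "(\<Prod>i = 0..<n. ?B $$ (i, p i)) = (\<Prod>i = 0..<n. ?A $$ (i, p i))" if p: "p permutes {0..<n}" for p
  proof -
    have pn: "p i < n" if "i < n" for i using p that permutes_in_image[of p "{0..<n}" i] by simp
    have "(\<Prod>i = 0..<n. ?B $$ (i, p i)) = (\<Prod>i = 0..<n. ?A $$ (i, p i) * (h (v (p i)) / h (v i)))"
      by (intro prod.cong) (simp_all add: pn conj vV)
    also have "\<dots> = (\<Prod>i = 0..<n. ?A $$ (i, p i)) * ((\<Prod>i = 0..<n. h (v (p i))) / (\<Prod>i = 0..<n. h (v i)))"
      by (simp only: prod.distrib prod_dividef)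
    also have "(\<Prod>i = 0..<n. h (v (p i))) = (\<Prod>i = 0..<n. h (v i))"
      using prod.permute[OF p, of "\<lambda>i. h (v i)"] by (simp add: o_def)
    finally show ?thesis using h vV by simp
  qed
  then have "Determinant.det ?B = Determinant.det ?A"
    by (subst (1 2) det_def'[of _ n]) (auto intro!: sum.cong simp del: index_mat)
  then show ?thesis
    using forest_sum_eq_det[OF bij, of N w] forest_sum_eq_det[OF bij, of N' w'] fin by simp
qed

subsection \<open>Primal and dual cycles in genus zero\<close>

text \<open>Gaussian elimination over arbitrary finite index sets, one equation per induction
  step.\<close>

lemma homogeneous_system_nontrivial:
  fixes M :: "'j \<Rightarrow> 'i \<Rightarrow> real"
  assumes "finite J" "finite I" "card J < card I"
  shows "\<exists>x. (\<exists>i\<in>I. x i \<noteq> 0) \<and> (\<forall>j\<in>J. (\<Sum>i\<in>I. M j i * x i) = 0)"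
  using assms
proof (induction J arbitrary: I M rule: finite_induct)
  case empty
  then obtain i where "i \<in> I" by (metis card.empty card_gt_0_iff ex_in_conv)
  then show ?case by (intro exI[of _ "\<lambda>_. 1"]) auto
next
  case (insert j J)
  show ?case
  proof (cases "\<forall>i\<in>I. M j i = 0")
    case True
    then show ?thesis using insert.IH[of I M] insert.prems insert.hyps by auto
  next
    case False
    then obtain k where k: "k \<in> I" "M j k \<noteq> 0" by auto
    \<comment> \<open>The remaining equations after equation \<open>j\<close> has been solved for
      the unknown \<open>k\<close>.\<close>
    define N where "N = (\<lambda>a i. M a i - M a k * M j i / M j k)"
    have "card J < card (I - {k})" using insert.prems insert.hyps k by auto
    then obtain x where x: "\<exists>i\<in>I - {k}. x i \<noteq> 0"
        "\<And>a. a \<in> J \<Longrightarrow> (\<Sum>i\<in>I - {k}. N a i * x i) = 0"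
      using insert.IH[of "I - {k}" N] insert.prems by auto
    define S where "S = (\<lambda>a. \<Sum>i\<in>I - {k}. M a i * x i)"
    define y where "y = x(k := - S j / M j k)"
    have split: "(\<Sum>i\<in>I. M a i * y i) = M a k * y k + S a" for a
    proof -
      have "(\<Sum>i\<in>I - {k}. M a i * y i) = S a"
        unfolding S_def y_def by (intro sum.cong) auto
      then show ?thesis using k insert.prems by (simp add: sum.remove)
    qed
    have "(\<Sum>i\<in>I. M a i * y i) = 0" if "a \<in> insert j J" for a
    proof (cases "a = j")
      case True
      then show ?thesis using k by (simp add: split) (simp add: y_def)
    next
      case False
      then have "a \<in> J" using that by simp
      have "(\<Sum>i\<in>I - {k}. N a i * x i) = S a - M a k / M j k * S j"
        unfolding S_def N_def sum_distrib_left sum_subtractf[symmetric]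
        by (intro sum.cong) (auto simp: algebra_simps)
      then show ?thesis using x(2)[OF \<open>a \<in> J\<close>] by (simp add: split) (simp add: y_def)
    qed
    moreover have "\<exists>i\<in>I. y i \<noteq> 0" using x(1) by (auto simp: y_def)
    ultimately show ?thesis by blast
  qed
qed

section \<open>Directed cycles in finite sets of darts\<close>

definition dart_rel :: "('d \<Rightarrow> 'a) \<Rightarrow> ('d \<Rightarrow> 'd) \<Rightarrow> 'd set \<Rightarrow> ('a \<times> 'a) set" where
  "dart_rel t s P = (\<lambda>d. (t d, t (s d))) ` P"

definition cycle_flow :: "('d \<Rightarrow> 'd) \<Rightarrow> 'd set \<Rightarrow> 'd \<Rightarrow> real" where
  "cycle_flow s C d = of_bool (d \<in> C) - of_bool (s d \<in> C)"

text \<open>The condition on \<open>h\<close> says that \<open>C\<close> is a single cycle and not a union of several.\<close>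

definition dart_cycle :: "('d \<Rightarrow> 'a) \<Rightarrow> ('d \<Rightarrow> 'd) \<Rightarrow> 'd set \<Rightarrow> bool" where
  "dart_cycle t s C \<longleftrightarrow> finite C \<and> C \<noteq> {} \<and> inj_on t C \<and> inj_on (t \<circ> s) C \<and> (t \<circ> s) ` C = t ` C \<and>
     (\<forall>h :: 'a \<Rightarrow> real. (\<forall>d\<in>C. h (t d) = h (t (s d))) \<longrightarrow> (\<forall>d\<in>C. \<forall>d'\<in>C. h (t d) = h (t d')))"

text \<open>A smallest nonempty set in which every point has a successor is a single cycle: the set
  of successors, and every nonempty level set of a function invariant along the darts, is again such
  a set and so cannot be smaller.\<close>

lemma dart_cycle_exists:
  assumes "finite P" "inj_on t P" "X \<noteq> {}" "finite X"
    and succ: "\<And>x. x \<in> X \<Longrightarrow> \<exists>d\<in>P. t d = x \<and> t (s d) \<in> X"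
  shows "\<exists>C\<subseteq>P. dart_cycle t s C \<and> t ` C \<subseteq> X"
proof -
  define ok where "ok = (\<lambda>Y. Y \<subseteq> X \<and> Y \<noteq> {} \<and> (\<forall>x\<in>Y. \<exists>d\<in>P. t d = x \<and> t (s d) \<in> Y))"
  have "ok X" using assms unfolding ok_def by auto
  then obtain Y where Y: "ok Y" and Ymin: "\<And>Z. ok Z \<Longrightarrow> card Y \<le> card Z"
    using ex_has_least_nat[of ok X card] by auto
  have finY: "finite Y" using Y \<open>finite X\<close> unfolding ok_def by (auto intro: finite_subset)
  have Ysub: "Z = Y" if "Z \<subseteq> Y" "ok Z" for Z
    using Ymin[OF that(2)] that(1) finY by (meson card_seteq)
  define C where "C = {d\<in>P. t d \<in> Y}"
  have tC: "t ` C = Y" using Y unfolding ok_def C_def by auto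
  have CP: "C \<subseteq> P" by (auto simp: C_def)
  have hC: "t (s d) \<in> Y" if "d \<in> C" for d
    using that Y \<open>inj_on t P\<close> unfolding ok_def C_def inj_on_def by fastforce
  have nxt: "\<exists>d\<in>C. t d = y" if "y \<in> Y" for y using that tC by auto
  have img: "(t \<circ> s) ` C = Y"
  proof (rule Ysub)
    show "(t \<circ> s) ` C \<subseteq> Y" using hC by auto
    moreover have "C \<noteq> {}" using tC Y unfolding ok_def by auto
    ultimately show "ok ((t \<circ> s) ` C)"
      unfolding ok_def using nxt CP Y unfolding ok_def by (auto simp: image_subset_iff) (metis hC image_eqI nxt subsetD)
  qed
  have finC: "finite C" using CP \<open>finite P\<close> finite_subset by blast
  have injC: "inj_on t C" using \<open>inj_on t P\<close> CP inj_on_subset by blast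
  have "inj_on (t \<circ> s) C"
    using img tC finC injC by (metis card_image eq_card_imp_inj_on)
  moreover have "h (t d) = h (t d')"
    if h: "\<forall>d\<in>C. h (t d) = h (t (s d))" and "d \<in> C" "d' \<in> C" for h :: "'b \<Rightarrow> real" and d d'
  proof -
    have "{y\<in>Y. h y = h (t d)} = Y"
    proof (rule Ysub)
      have "\<exists>e\<in>P. t e = x \<and> t (s e) \<in> Y \<and> h (t (s e)) = h (t d)" if "x \<in> Y" "h x = h (t d)" for x
        using nxt[OF that(1)] hC CP h that(2) by fastforce
      then show "ok {y\<in>Y. h y = h (t d)}"
        unfolding ok_def using tC that(2) Y unfolding ok_def by auto
    qed auto
    moreover have "t d' \<in> Y" using that(3) tC by auto
    ultimately have "t d' \<in> {y\<in>Y. h y = h (t d)}" by simp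
    then show ?thesis by simp
  qed
  ultimately have "dart_cycle t s C"
    unfolding dart_cycle_def using finC injC img tC Y unfolding ok_def by auto
  then show ?thesis using CP tC Y unfolding ok_def by blast
qed

lemma acyclic_if_no_dart_cycle:
  assumes "finite P" "inj_on t P" and no: "\<And>C. C \<subseteq> P \<Longrightarrow> \<not> dart_cycle t s C"
  shows "acyclic (dart_rel t s P)"
proof (rule ccontr)
  assume "\<not> acyclic (dart_rel t s P)"
  then obtain y where y: "(y, y) \<in> (dart_rel t s P)\<^sup>+" unfolding acyclic_def by auto
  define X where "X = {z. (z, y) \<in> (dart_rel t s P)\<^sup>+}"
  have "X \<subseteq> t ` P" unfolding X_def dart_rel_def by (auto dest!: tranclD)
  then have "finite X" using \<open>finite P\<close> finite_subset by blast
  have "\<exists>d\<in>P. t d = x \<and> t (s d) \<in> X" if "x \<in> X" for x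
  proof -
    from that obtain z where z: "(x, z) \<in> dart_rel t s P" "(z, y) \<in> (dart_rel t s P)\<^sup>*"
      unfolding X_def by (auto dest: tranclD)
    have "z \<in> X" using z(2) y unfolding X_def by (auto simp: rtrancl_eq_or_trancl)
    then show ?thesis using z(1) unfolding dart_rel_def by auto
  qed
  then show False using dart_cycle_exists[OF assms(1,2) _ \<open>finite X\<close>] no y X_def by blast
qed

text \<open>A dart in \<open>P\<close> stands for the dimer from its crossing to its tail, a dart in
  \<open>Q\<close> for the dimer from its crossing to the face on its left. Both halves are recorded
  by darts so that the notion is symmetric under duality.\<close>

definition dimer_pair ::
  "'d set \<Rightarrow> ('d \<Rightarrow> 'd) \<Rightarrow> ('d \<Rightarrow> 'a) \<Rightarrow> ('d \<Rightarrow> 'b) \<Rightarrow> 'a \<Rightarrow> 'b \<Rightarrow> 'd set \<Rightarrow> 'd set \<Rightarrow> bool" where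
  "dimer_pair D s t l p q P Q \<longleftrightarrow> P \<subseteq> D \<and> Q \<subseteq> D \<and>
     bij_betw t P (t ` D - {p}) \<and> bij_betw l Q (l ` D - {q}) \<and>
     (\<forall>d\<in>P. s d \<notin> P \<and> d \<notin> Q \<and> s d \<notin> Q) \<and> (\<forall>d\<in>Q. s d \<notin> Q) \<and>
     (\<forall>d\<in>D. d \<in> P \<or> s d \<in> P \<or> d \<in> Q \<or> s d \<in> Q)"

text \<open>
  \<open>s\<close> reverses a dart, \<open>rho\<close> rotates around its tail \<open>t\<close>, \<open>l\<close> is the face on its left, and \<open>J\<close>
  contains one dart of each edge.  The roots \<open>p\<close> (a vertex) and \<open>q\<close> (a face) are incident.  Duality
  exchanges \<open>t\<close> with \<open>l\<close> and \<open>p\<close> with \<open>q\<close>.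
\<close>

locale spherical_map =
  fixes D J :: "'d set" and s rho :: "'d \<Rightarrow> 'd" and t :: "'d \<Rightarrow> 'a" and l :: "'d \<Rightarrow> 'b"
    and p :: 'a and q :: 'b
  assumes fin: "finite D"
    and s_in: "d \<in> D \<Longrightarrow> s d \<in> D"
    and s_s [simp]: "s (s d) = d"
    and J_sub: "J \<subseteq> D" and J_cover: "J \<union> s ` J = D" and J_disj: "J \<inter> s ` J = {}"
    and rho_in: "d \<in> D \<Longrightarrow> rho d \<in> D"
    and rho_inj: "inj_on rho D"
    and t_rho: "d \<in> D \<Longrightarrow> t (rho d) = t d"
    and l_rho: "d \<in> D \<Longrightarrow> l (rho d) = l (s d)"
    and t_orbit: "\<lbrakk>d \<in> D; d' \<in> D; t d = t d'\<rbrakk> \<Longrightarrow> \<exists>n. d' = (rho ^^ n) d"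
    and l_orbit: "\<lbrakk>d \<in> D; d' \<in> D; l d = l d'\<rbrakk> \<Longrightarrow> \<exists>n. d' = ((rho \<circ> s) ^^ n) d"
    and connected: "\<lbrakk>\<forall>d\<in>D. h (t d) = h (t (s d)); d \<in> D; d' \<in> D\<rbrakk> \<Longrightarrow> h (t d) = (h (t d') :: real)"
    and euler: "card (t ` D) + card (l ` D) = card J + 2"
    and root: "\<exists>d\<in>D. t d = p \<and> l d = q"
begin

section \<open>Duality, gradients and boundaries on a spherical map\<close>

lemma const_around:
  assumes "\<And>d. \<lbrakk>d \<in> D; t d = x\<rbrakk> \<Longrightarrow> f (l d) = f (l (s d))"
    and "d \<in> D" "d' \<in> D" "t d = x" "t d' = x"
  shows "f (l d) = f (l d')"
proof -
  have "(rho ^^ n) d \<in> D \<and> t ((rho ^^ n) d) = x \<and> f (l ((rho ^^ n) d)) = f (l d)" for n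
    by (induction n) (use assms in \<open>auto simp: rho_in t_rho l_rho\<close>)
  then show ?thesis using t_orbit[of d d'] assms by metis
qed

text \<open>Connectivity is expressed through functions, and in this form it dualizes: a face
  function that is constant across edges is constant around each vertex, hence descends to a vertex
  function that is constant along edges.\<close>

lemma dual_connected:
  fixes f :: "'b \<Rightarrow> real"
  assumes f: "\<forall>d\<in>D. f (l d) = f (l (s d))" and "d \<in> D" "d' \<in> D"
  shows "f (l d) = f (l d')"
proof -
  define h where "h = (\<lambda>x. f (l (SOME e. e \<in> D \<and> t e = x)))"
  have h: "h (t e) = f (l e)" if "e \<in> D" for e
  proof -
    have "(SOME e'. e' \<in> D \<and> t e' = t e) \<in> D \<and> t (SOME e'. e' \<in> D \<and> t e' = t e) = t e"
      by (rule someI[of _ e]) (use that in auto)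
    then show ?thesis unfolding h_def using const_around[of "t e" f _ e] f that by blast
  qed
  have "\<forall>e\<in>D. h (t e) = h (t (s e))" using f s_in h by metis
  from connected[OF this assms(2,3)] show ?thesis using h assms(2,3) by metis
qed

text \<open>The dual rotation is the face permutation, and composing it with \<open>s\<close> gives
  back \<open>rho\<close>. Facts about vertices and primal cycles thus transfer to faces and dual
  cycles.\<close>

lemma dual: "spherical_map D J s (rho \<circ> s) l t q p"
proof (unfold_locales, goal_cases)
  case 8 then show ?case
    by (metis (no_types, lifting) comp_inj_on_iff fin finite_surj inj_on_def inj_on_subset rho_inj s_in s_s image_subset_iff o_apply)
next
  case (12 d d')
  have "rho \<circ> s \<circ> s = rho" by (simp add: fun_eq_iff)
  then show ?case using t_orbit[OF 12] by simp
next
  case 13 then show ?case using dual_connected by blast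
qed (use fin s_in J_sub J_cover J_disj rho_in t_rho l_rho l_orbit euler root in \<open>auto simp: o_def\<close>)

lemma sum_swap: "(\<Sum>d\<in>D. g (s d)) = (\<Sum>d\<in>D. g d)"
  by (rule sum.reindex_bij_witness[of _ s s]) (auto simp: s_in)

lemma boundary_divergence_free:
  fixes f :: "'b \<Rightarrow> real"
  shows "(\<Sum>d | d \<in> D \<and> t d = x. f (l d) - f (l (s d))) = 0"
proof -
  let ?X = "{d \<in> D. t d = x}"
  have "rho ` ?X = ?X"
    by (rule endo_inj_surj) (use fin rho_in t_rho rho_inj in \<open>auto intro: inj_on_subset\<close>)
  then have "(\<Sum>d\<in>?X. f (l d)) = (\<Sum>d\<in>?X. f (l (rho d)))"
    using sum.reindex[of rho ?X "\<lambda>d. f (l d)"] rho_inj by (auto simp: o_def intro: inj_on_subset)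
  also have "\<dots> = (\<Sum>d\<in>?X. f (l (s d)))" by (rule sum.cong) (auto simp: l_rho)
  finally show ?thesis by (simp add: sum_subtractf)
qed

text \<open>Summation by parts: grouped by tails, the terms with \<open>f (t d)\<close> vanish, and
  reversal of the darts reduces the other terms to these.\<close>

lemma gradient_orthogonal:
  fixes f :: "'a \<Rightarrow> real"
  assumes anti: "\<And>d. d \<in> D \<Longrightarrow> g (s d) = - g d"
    and div: "\<And>x. (\<Sum>d | d \<in> D \<and> t d = x. g d) = 0"
  shows "(\<Sum>d\<in>D. (f (t d) - f (t (s d))) * g d) = 0"
proof -
  have 1: "(\<Sum>d\<in>D. f (t d) * g d) = 0"
  proof -
    have "(\<Sum>d\<in>D. f (t d) * g d) = (\<Sum>x\<in>t ` D. \<Sum>d | d \<in> D \<and> t d = x. f (t d) * g d)"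
      by (rule sum.image_gen[OF fin])
    also have "\<dots> = (\<Sum>x\<in>t ` D. f x * (\<Sum>d | d \<in> D \<and> t d = x. g d))"
      unfolding sum_distrib_left by (intro sum.cong) auto
    finally show ?thesis by (simp add: div)
  qed
  have "(\<Sum>d\<in>D. f (t (s d)) * g d) = (\<Sum>d\<in>D. f (t d) * g (s d))"
    using sum_swap[of "\<lambda>d. f (t d) * g (s d)"] by simp
  also have "\<dots> = - (\<Sum>d\<in>D. f (t d) * g d)"
    unfolding sum_negf[symmetric] by (intro sum.cong) (auto simp: anti)
  finally show ?thesis using 1 by (simp add: left_diff_distrib sum_subtractf)
qed

text \<open>
  Gradients and boundaries are orthogonal spaces of antisymmetric functions on darts, and by
  Euler's formula their dimensions add up to the number of edges.
\<close>

lemma divergence_free_is_boundary: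
  fixes g :: "'d \<Rightarrow> real"
  assumes anti: "\<And>d. d \<in> D \<Longrightarrow> g (s d) = - g d"
    and div: "\<And>x. (\<Sum>d | d \<in> D \<and> t d = x. g d) = 0"
  shows "\<exists>f. f q = 0 \<and> (\<forall>d\<in>D. g d = f (l d) - f (l (s d)))"
proof -
  \<comment> \<open>One unknown for \<open>g\<close>, one for each vertex other than
    \<open>p\<close> and one for each face other than \<open>q\<close>. Omitting the roots removes
    the constants; by Euler's formula there is exactly one unknown more than edges.\<close>
  define I where "I = insert None (Some ` ((t ` D - {p}) <+> (l ` D - {q})))"
  define M :: "'d \<Rightarrow> ('a + 'b) option \<Rightarrow> real" where
    "M = (\<lambda>d i. case i of None \<Rightarrow> g d
       | Some (Inl x) \<Rightarrow> of_bool (t d = x) - of_bool (t (s d) = x)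
       | Some (Inr u) \<Rightarrow> of_bool (l d = u) - of_bool (l (s d) = u))"
  have pq: "p \<in> t ` D" "q \<in> l ` D" using root by auto
  have finI: "finite I" unfolding I_def using fin by auto
  have "card I = 1 + ((card (t ` D) - 1) + (card (l ` D) - 1))"
    unfolding I_def using fin pq by (simp add: card_insert_if card_image card_Plus image_iff)
  moreover have "card (t ` D) > 0" "card (l ` D) > 0" using fin pq by (auto simp: card_gt_0_iff)
  ultimately have "card J < card I" using euler by simp
  moreover have "finite J" using fin J_sub finite_subset by blast
  ultimately obtain x where nz: "\<exists>i\<in>I. x i \<noteq> 0" and sol: "\<And>d. d \<in> J \<Longrightarrow> (\<Sum>i\<in>I. M d i * x i) = 0"
    using homogeneous_system_nontrivial[of J I M] finI by auto
  define a where "a = (\<lambda>y. if y \<in> t ` D - {p} then x (Some (Inl y)) else 0)"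
  define b where "b = (\<lambda>u. if u \<in> l ` D - {q} then x (Some (Inr u)) else 0)"
  define al where "al = (\<lambda>d. a (t d) - a (t (s d)))"
  define be where "be = (\<lambda>d. b (l d) - b (l (s d)))"
  have expand: "(\<Sum>i\<in>I. M d i * x i) = g d * x None + al d + be d" if d: "d \<in> D" for d
  proof -
    have A: "(\<Sum>y\<in>t ` D - {p}. of_bool (z = y) * x (Some (Inl y))) = a z" if "z \<in> t ` D" for z
      using fin that unfolding a_def by (auto simp: of_bool_def if_distrib[of "\<lambda>z. z * _"] sum.delta cong: if_cong)
    have B: "(\<Sum>y\<in>l ` D - {q}. of_bool (z = y) * x (Some (Inr y))) = b z" if "z \<in> l ` D" for z
      using fin that unfolding b_def by (auto simp: of_bool_def if_distrib[of "\<lambda>z. z * _"] sum.delta cong: if_cong)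
    have "(\<Sum>i\<in>I. M d i * x i) = g d * x None +
        ((\<Sum>y\<in>t ` D - {p}. M d (Some (Inl y)) * x (Some (Inl y))) +
         (\<Sum>u\<in>l ` D - {q}. M d (Some (Inr u)) * x (Some (Inr u))))"
      unfolding I_def using fin by (simp add: sum.reindex sum.Plus M_def image_iff o_def)
    also have "(\<Sum>y\<in>t ` D - {p}. M d (Some (Inl y)) * x (Some (Inl y))) = al d"
      unfolding al_def using A[of "t d"] A[of "t (s d)"] d s_in[OF d]
      by (simp add: M_def left_diff_distrib sum_subtractf)
    also have "(\<Sum>u\<in>l ` D - {q}. M d (Some (Inr u)) * x (Some (Inr u))) = be d"
      unfolding be_def using B[of "l d"] B[of "l (s d)"] d s_in[OF d]
      by (simp add: M_def left_diff_distrib sum_subtractf)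
    finally show ?thesis by simp
  qed
  have eqJ: "g d * x None + al d + be d = 0" if "d \<in> J" for d
    using expand[of d] sol[OF that] that J_sub by auto
  have eq: "g d * x None + al d + be d = 0" if dD: "d \<in> D" for d
  proof (cases "d \<in> J")
    case False
    then obtain e where e: "e \<in> J" "d = s e" using J_cover dD by blast
    then show ?thesis using eqJ[OF e(1)] anti[of e] J_sub by (auto simp: al_def be_def)
  qed (rule eqJ)
  \<comment> \<open>By the linear relation the second factor is \<open>- al d\<close>, and it is
    divergence-free. The gradient \<open>al\<close> is therefore orthogonal to itself and
    vanishes.\<close>
  have "(\<Sum>d\<in>D. al d * (be d + x None * g d)) = 0"
    unfolding al_def
  proof (rule gradient_orthogonal)
    show "be (s d) + x None * g (s d) = - (be d + x None * g d)" if "d \<in> D" for d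
      using anti[OF that] by (simp add: be_def)
    show "(\<Sum>d | d \<in> D \<and> t d = y. be d + x None * g d) = 0" for y
      using boundary_divergence_free[of b y] div[of y]
      by (simp add: be_def sum.distrib sum_distrib_left[symmetric])
  qed
  also have "(\<Sum>d\<in>D. al d * (be d + x None * g d)) = - (\<Sum>d\<in>D. al d * al d)"
    unfolding sum_negf[symmetric]
  proof (rule sum.cong)
    fix d assume "d \<in> D"
    then have "be d + x None * g d = - al d" using eq[of d] by (simp add: algebra_simps)
    then show "al d * (be d + x None * g d) = - (al d * al d)" by simp
  qed auto
  finally have "\<forall>d\<in>D. al d * al d = 0" using fin by (subst (asm) neg_equal_0_iff_equal, subst (asm) sum_nonneg_eq_0_iff) auto
  then have al0: "al d = 0" if "d \<in> D" for d using that by simp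
  have be: "be d = - (x None * g d)" if "d \<in> D" for d using eq[OF that] al0[OF that] by (simp add: mult.commute)
  obtain d0 where d0: "d0 \<in> D" "t d0 = p" "l d0 = q" using root by auto
  \<comment> \<open>If \<open>g\<close> had coefficient 0, both potentials would be constant, hence
    zero by their values at the roots, and the solution would be trivial.\<close>
  have x0: "x None \<noteq> 0"
  proof
    assume z: "x None = 0"
    have "a (t d) = a p" if "d \<in> D" for d
      using connected[of a d d0] al0 that d0 by (auto simp: al_def)
    moreover have "b (l d) = b q" if "d \<in> D" for d
      using dual_connected[of b d d0] be z that d0 by (auto simp: be_def)
    moreover have "a p = 0" "b q = 0" by (auto simp: a_def b_def)
    ultimately have ab: "a y = 0" "b u = 0" if "y \<in> t ` D" "u \<in> l ` D" for y u using that by auto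
    have "x (Some (Inl y)) = 0" if "y \<in> t ` D - {p}" for y
      using ab(1)[of y q] that pq by (simp add: a_def)
    moreover have "x (Some (Inr u)) = 0" if "u \<in> l ` D - {q}" for u
      using ab(2)[of p u] that pq by (simp add: b_def)
    ultimately have "x i = 0" if "i \<in> I" for i using that z unfolding I_def by blast
    then show False using nz by auto
  qed
  show ?thesis
    by (rule exI[of _ "\<lambda>u. - b u / x None"])
      (use be x0 in \<open>auto simp: be_def b_def field_simps\<close>)
qed

section \<open>Winding numbers and nested cycles\<close>

lemma cycle_flow_boundary:
  assumes "C \<subseteq> D" and C: "dart_cycle t s C"
  shows "\<exists>f. f q = 0 \<and> (\<forall>d\<in>D. cycle_flow s C d = f (l d) - f (l (s d)))"
proof (rule divergence_free_is_boundary)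
  show "cycle_flow s C (s d) = - cycle_flow s C d" for d by (simp add: cycle_flow_def)
  show "(\<Sum>d | d \<in> D \<and> t d = x. cycle_flow s C d) = 0" for x
  proof -
    \<comment> \<open>Applied to tails and to heads of \<open>C\<close>: both are injective with the
      same image, so a vertex is entered as often as it is left.\<close>
    have one: "card {d \<in> C. f d = x} = of_bool (x \<in> f ` C)" if "inj_on f C" for f :: "'d \<Rightarrow> 'a"
    proof (cases "x \<in> f ` C")
      case True
      then obtain d where "d \<in> C" "f d = x" by auto
      then have "{d \<in> C. f d = x} = {d}" using that by (auto simp: inj_on_def)
      then show ?thesis using True by simp
    qed (auto intro: card_eq_0_iff[THEN iffD2])
    let ?X = "{d \<in> D. t d = x}"
    have finX: "finite ?X" using fin by simp
    have "(\<Sum>d\<in>?X. of_bool (d \<in> C) :: real) = card (?X \<inter> C)"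
      using finX by (simp add: sum.If_cases of_bool_def Int_def)
    also have "?X \<inter> C = {d \<in> C. t d = x}" using \<open>C \<subseteq> D\<close> by auto
    finally have 1: "(\<Sum>d\<in>?X. of_bool (d \<in> C) :: real) = card {d \<in> C. t d = x}" .
    have "(\<Sum>d\<in>?X. of_bool (s d \<in> C) :: real) = card (?X \<inter> {d. s d \<in> C})"
      using finX by (simp add: sum.If_cases of_bool_def Int_def)
    also have "card (?X \<inter> {d. s d \<in> C}) = card {d \<in> C. (t \<circ> s) d = x}"
      by (rule bij_betw_same_card[of s], rule bij_betw_byWitness[of _ s]) (use \<open>C \<subseteq> D\<close> s_in in auto)
    finally have 2: "(\<Sum>d\<in>?X. of_bool (s d \<in> C) :: real) = card {d \<in> C. (t \<circ> s) d = x}" .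
    have "card {d \<in> C. t d = x} = card {d \<in> C. (t \<circ> s) d = x}"
      using C by (simp only: dart_cycle_def one)
    then show ?thesis
      unfolding cycle_flow_def sum_subtractf 1 2 by simp
  qed
qed

text \<open>
  \<open>a\<close> and \<open>b\<close> are the winding numbers of the primal cycle \<open>C\<close> and the dual cycle \<open>C'\<close>.  Resetting \<open>b\<close>
  to its constant value on \<open>C\<close> at every vertex that is not strictly inside \<open>C\<close> does not change its
  gradient, so this value is \<open>b p = 0\<close>.
\<close>

lemma nested_cycle:
  assumes pair: "dimer_pair D s t l p q P Q"
    and C: "C \<subseteq> P" "dart_cycle t s C" and C': "C' \<subseteq> Q" "dart_cycle l s C'"
    and a: "a q = 0" "\<And>d. d \<in> D \<Longrightarrow> cycle_flow s C d = a (l d) - a (l (s d))"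
    and b: "b p = 0" "\<And>d. d \<in> D \<Longrightarrow> cycle_flow s C' d = b (t d) - b (t (s d))"
    and inside: "\<And>d. d \<in> C' \<Longrightarrow> a (l d) \<noteq> 0"
    and d: "d \<in> D" "b (t d) \<noteq> 0"
  shows "t d \<notin> t ` C \<and> a (l d) \<noteq> 0"
proof -
  have PD: "P \<subseteq> D" "Q \<subseteq> D" using pair unfolding dimer_pair_def by auto
  have headC: "t (s e) \<in> t ` C" if "e \<in> C" for e
    using C(2) that unfolding dart_cycle_def by auto
  have headC': "l (s e) \<in> l ` C'" if "e \<in> C'" for e
    using C'(2) that unfolding dart_cycle_def by auto
  have around: "a (l e) = a (l e')" if "e \<in> D" "e' \<in> D" "t e = x" "t e' = x" "x \<notin> t ` C" for e e' x
  proof (rule const_around[of x])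
    fix e assume e: "e \<in> D" "t e = x"
    then have "e \<notin> C" "s e \<notin> C" using headC[of "s e"] that(5) by auto
    then show "a (l e) = a (l (s e))" using a(2)[OF e(1)] by (simp add: cycle_flow_def)
  qed (use that in auto)
  have b_eq: "b (t e) = b (t (s e))" if "e \<in> D" "e \<notin> C'" "s e \<notin> C'" for e
    using b(2)[OF that(1)] that by (simp add: cycle_flow_def)
  have CC': "e \<notin> C' \<and> s e \<notin> C'" if "e \<in> C" for e
    using that pair C(1) C'(1) unfolding dimer_pair_def by blast
  obtain c0 where c0: "c0 \<in> C" using C(2) unfolding dart_cycle_def by auto
  have "\<forall>e\<in>C. b (t e) = b (t (s e))" using b_eq CC' C(1) PD by blast
  then have bC: "b x = b (t c0)" if "x \<in> t ` C" for x
    using C(2) c0 that unfolding dart_cycle_def by blast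
  define Y where "Y = t ` C \<union> {x. \<exists>e\<in>D. t e = x \<and> a (l e) = 0}"
  define b' where "b' = (\<lambda>x. if x \<in> Y then b (t c0) else b x)"
  have touch: "b' (t e) = b (t e)" if "e \<in> D" "a (l e) \<noteq> 0" for e
    using around[of e _ "t e"] that bC unfolding b'_def Y_def by (auto split: if_splits) (metis that)+
  \<comment> \<open>The face on the left of an edge has a corner at its head as well as at its
    tail.\<close>
  have facing: "\<exists>e'\<in>D. t e' = t (s e) \<and> l e' = l e" if "e \<in> D" for e
    by (rule bexI[of _ "rho (s e)"]) (use that s_in rho_in t_rho l_rho in auto)
  \<comment> \<open>The two faces at an edge crossed by \<open>C'\<close> both lie on
    \<open>C'\<close>, hence inside \<open>C\<close>, so the reset changes neither endpoint.\<close>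
  have imp: "b' (t (s e)) = b (t (s e)) \<and> b' (t e) = b (t e)" if "e \<in> C'" for e
  proof -
    have e: "e \<in> D" using that C'(1) PD by auto
    have "a (l (s e)) \<noteq> 0" using headC'[OF that] inside by auto
    then show ?thesis using touch[of e] touch[of "s e"] inside[OF that] e s_in by auto
  qed
  \<comment> \<open>An edge that leaves \<open>Y\<close> without crossing \<open>C'\<close> starts
    on \<open>C\<close>: its head touches only faces with nonzero \<open>a\<close>, and one of these
    also touches its tail.\<close>
  have step: "b' (t e) = b' (t (s e))"
    if e: "e \<in> D" "e \<notin> C'" "s e \<notin> C'" "t e \<in> Y" "t (s e) \<notin> Y" for e
  proof -
    have "a (l e) \<noteq> 0" using facing[OF e(1)] e(5) unfolding Y_def by auto
    then have "t e \<in> t ` C"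
      using around[OF _ e(1), of _ "t e"] e(4) unfolding Y_def by force
    then show ?thesis using bC[of "t e"] b_eq[OF e(1-3)] e(4,5) by (simp add: b'_def)
  qed
  have grad: "b' (t e) - b' (t (s e)) = b (t e) - b (t (s e))" if e: "e \<in> D" for e
  proof (cases "e \<in> C' \<or> s e \<in> C'")
    case True
    then show ?thesis using imp[of e] imp[of "s e"] by auto
  next
    case False
    then have eq: "b (t e) = b (t (s e))" using b_eq e by blast
    have "b' (t e) = b' (t (s e))"
      using step[of e] step[of "s e"] e s_in False eq
      by (cases "t e \<in> Y"; cases "t (s e) \<in> Y") (auto simp: b'_def)
    then show ?thesis using eq by simp
  qed
  have c0D: "c0 \<in> D" using c0 C(1) PD by auto
  have same: "b' (t e) = b (t e)" if "e \<in> D" for e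
    using connected[of "\<lambda>x. b' x - b x" e c0] grad that c0 c0D
    by (auto simp: b'_def algebra_simps Y_def)
  \<comment> \<open>Here the incidence of the roots is decisive: \<open>p\<close> touches the face
    \<open>q\<close>, where \<open>a\<close> vanishes, so \<open>p\<close> belongs to
    \<open>Y\<close> and determines the constant.\<close>
  have "b (t c0) = 0"
  proof -
    obtain d0 where d0: "d0 \<in> D" "t d0 = p" "l d0 = q" using root by auto
    then have "p \<in> Y" using a(1) unfolding Y_def by auto
    then show ?thesis using same[OF d0(1)] d0 b(1) by (simp add: b'_def)
  qed
  then have "t d \<notin> Y" using same[OF d(1)] d(2) by (auto simp: b'_def)
  then show ?thesis using d(1) unfolding Y_def by auto
qed

lemma dimer_pair_dual: "dimer_pair D s t l p q P Q \<Longrightarrow> dimer_pair D s l t q p Q P"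
  unfolding dimer_pair_def by (auto; metis s_s)

text \<open>The dual dimer of an enclosed face cannot cross \<open>C\<close>, whose edges are taken
  by primal dimers, so it leads to an enclosed face again. The root face, which has no dimer, is not
  enclosed.\<close>

lemma nonzero_boundary_cycle:
  assumes pair: "dimer_pair D s t l p q P Q" and C: "C \<subseteq> P" "dart_cycle t s C"
    and a: "a q = 0" "\<And>d. d \<in> D \<Longrightarrow> cycle_flow s C d = a (l d) - a (l (s d))"
  shows "\<exists>C'\<subseteq>Q. dart_cycle l s C' \<and> (\<forall>d\<in>C'. a (l d) \<noteq> 0)"
proof -
  let ?X = "{u \<in> l ` D. a u \<noteq> 0}"
  have PD: "P \<subseteq> D" "Q \<subseteq> D" using pair unfolding dimer_pair_def by auto
  have "\<exists>C'\<subseteq>Q. dart_cycle l s C' \<and> l ` C' \<subseteq> ?X"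
  proof (rule dart_cycle_exists)
    show "finite Q" "finite ?X" using PD fin by (auto intro: finite_subset)
    show "inj_on l Q" using pair unfolding dimer_pair_def bij_betw_def by auto
    obtain c0 where c0: "c0 \<in> C" using C(2) unfolding dart_cycle_def by auto
    have "s c0 \<notin> C" "c0 \<in> D" using pair c0 C(1) unfolding dimer_pair_def by blast+
    then have "a (l c0) \<noteq> 0 \<or> a (l (s c0)) \<noteq> 0" "s c0 \<in> D"
      using a(2)[of c0] c0 s_in by (auto simp: cycle_flow_def)
    then show "?X \<noteq> {}" using \<open>c0 \<in> D\<close> by blast
    fix u assume u: "u \<in> ?X"
    then have "u \<in> l ` D - {q}" using a(1) by auto
    then obtain d where d: "d \<in> Q" "l d = u"
      using pair unfolding dimer_pair_def bij_betw_def by (metis imageE)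
    have dD: "d \<in> D" using d PD by auto
    have "d \<notin> C" "s d \<notin> C" using d pair C(1) unfolding dimer_pair_def by (metis s_s subsetD)+
    then have "a (l (s d)) = a (l d)" using a(2)[OF dD] by (simp add: cycle_flow_def)
    then show "\<exists>d\<in>Q. l d = u \<and> l (s d) \<in> ?X" using d u s_in[OF dD] by auto
  qed
  then show ?thesis by blast
qed

lemma dimer_pair_no_cycle:
  assumes pair: "dimer_pair D s t l p q P Q"
  shows "\<not> (C \<subseteq> P \<and> dart_cycle t s C)"
proof
  interpret dual: spherical_map D J s "rho \<circ> s" l t q p by (rule dual)
  have PD: "P \<subseteq> D" "Q \<subseteq> D" using pair unfolding dimer_pair_def by auto
  define cyc where "cyc = (\<lambda>C a. C \<subseteq> P \<and> dart_cycle t s C \<and> a q = 0 \<and>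
    (\<forall>d\<in>D. cycle_flow s C d = a (l d) - a (l (s d))))"
  define R where "R = (\<lambda>a :: 'b \<Rightarrow> real. {u \<in> l ` D. a u \<noteq> 0})"
  assume "C \<subseteq> P \<and> dart_cycle t s C"
  then have "\<exists>C a. cyc C a" using cycle_flow_boundary[of C] PD unfolding cyc_def by blast
  then obtain n where "\<exists>C a. cyc C a \<and> card (R a) = n" by auto
  then show False
  proof (induction n rule: less_induct)
    case (less n)
    then obtain C a where Ca: "cyc C a" "card (R a) = n" by auto
    then obtain C' where C': "C' \<subseteq> Q" "dart_cycle l s C'" "\<forall>d\<in>C'. a (l d) \<noteq> 0"
      using nonzero_boundary_cycle[OF pair, of C a] unfolding cyc_def by blast
    then obtain b where b: "b p = 0" "\<And>d. d \<in> D \<Longrightarrow> cycle_flow s C' d = b (t d) - b (t (s d))"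
      using dual.cycle_flow_boundary[of C'] PD by blast
    obtain C'' where C'': "C'' \<subseteq> P" "dart_cycle t s C''" "\<forall>d\<in>C''. b (t d) \<noteq> 0"
      using dual.nonzero_boundary_cycle[OF dimer_pair_dual[OF pair] C'(1,2) b] by blast
    then obtain a' where a': "a' q = 0" "\<And>d. d \<in> D \<Longrightarrow> cycle_flow s C'' d = a' (l d) - a' (l (s d))"
      using cycle_flow_boundary[of C''] PD by blast
    have 1: "t d \<notin> t ` C \<and> a (l d) \<noteq> 0" if "d \<in> D" "b (t d) \<noteq> 0" for d
      using nested_cycle[OF pair _ _ C'(1,2) _ _ b _ that, of C a] Ca C'(3) unfolding cyc_def by blast
    have 2: "l d \<notin> l ` C' \<and> b (t d) \<noteq> 0" if "d \<in> D" "a' (l d) \<noteq> 0" for d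
      using dual.nested_cycle[OF dimer_pair_dual[OF pair] C'(1,2) C''(1,2) b a' _ that] C''(3) by blast
    obtain c0 where c0: "c0 \<in> C'" using C'(2) unfolding dart_cycle_def by auto
    then have c0D: "c0 \<in> D" using C'(1) PD by auto
    \<comment> \<open>Strictness comes from the faces visited by \<open>C'\<close>: they are
      enclosed by \<open>C\<close> but not by \<open>C''\<close>.\<close>
    have "R a' \<subset> R a"
    proof
      show "R a' \<subseteq> R a" using 1 2 unfolding R_def by auto
      have "l c0 \<in> R a" using c0 c0D C'(3) unfolding R_def by auto
      moreover have "l c0 \<notin> R a'" using 2[OF c0D] c0 unfolding R_def by auto
      ultimately show "R a' \<noteq> R a" by auto
    qed
    then have "card (R a') < n" using Ca(2) fin by (metis R_def finite_Collect_conjI finite_imageI psubset_card_mono Collect_mem_eq)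
    moreover have "cyc C'' a'" unfolding cyc_def using C'' a' by blast
    ultimately show False using less.IH by blast
  qed
qed

lemma dimer_pair_acyclic:
  assumes pair: "dimer_pair D s t l p q P Q"
  shows "acyclic (dart_rel t s P)"
proof (rule acyclic_if_no_dart_cycle)
  show "finite P" using pair fin unfolding dimer_pair_def by (auto intro: finite_subset)
  show "inj_on t P" using pair unfolding dimer_pair_def bij_betw_def by auto
qed (use dimer_pair_no_cycle[OF pair] in blast)

text \<open>A dart of \<open>Q2\<close> outside \<open>Q1\<close> has its reversal in
  \<open>Q1\<close>, so the face it leads to is not the root, and the dart of \<open>Q2\<close> at
  that face is again outside \<open>Q1\<close>. The resulting walk never ends, against acyclicity of
  the dual half.\<close>

lemma dimer_pair_unique:
  assumes pair: "dimer_pair D s t l p q P Q" and pair': "dimer_pair D s t l p q P Q'"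
  shows "Q = Q'"
proof -
  interpret dual: spherical_map D J s "rho \<circ> s" l t q p by (rule dual)
  have sub: "Q2 \<subseteq> Q1" if A: "dimer_pair D s t l p q P Q1" and B: "dimer_pair D s t l p q P Q2" for Q1 Q2
  proof (rule ccontr)
    assume "\<not> Q2 \<subseteq> Q1"
    define X where "X = {d \<in> Q2. d \<notin> Q1}"
    have "finite (dart_rel l s Q2)"
      using B fin unfolding dimer_pair_def dart_rel_def by (auto intro: finite_subset)
    then have wf: "wf ((dart_rel l s Q2)\<inverse>)"
      using dual.dimer_pair_acyclic[OF dimer_pair_dual[OF B]] finite_acyclic_wf_converse by blast
    have "l ` X \<noteq> {}" using \<open>\<not> Q2 \<subseteq> Q1\<close> X_def by auto
    then obtain u where u: "u \<in> l ` X" and umin: "\<And>y. (u, y) \<in> dart_rel l s Q2 \<Longrightarrow> y \<notin> l ` X"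
      using wf unfolding wf_eq_minimal by (metis converse_iff ex_in_conv)
    obtain d where d: "d \<in> Q2" "d \<notin> Q1" "l d = u" using u X_def by auto
    have dD: "d \<in> D" using d B unfolding dimer_pair_def by auto
    have "d \<notin> P" "s d \<notin> P" using d B unfolding dimer_pair_def by (metis s_s)+
    then have sd: "s d \<in> Q1" using A d dD unfolding dimer_pair_def by blast
    then have "l (s d) \<in> l ` D - {q}" using A unfolding dimer_pair_def bij_betw_def by auto
    then obtain e where e: "e \<in> Q2" "l e = l (s d)"
      using B unfolding dimer_pair_def bij_betw_def by (metis imageE)
    have "e \<noteq> s d" using e d B unfolding dimer_pair_def by (metis s_s)
    then have "e \<notin> Q1" using sd e(2) A unfolding dimer_pair_def bij_betw_def inj_on_def by metis
    then have "l (s d) \<in> l ` X" using e X_def by (metis (mono_tags, lifting) image_eqI mem_Collect_eq)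
    then show False using umin[of "l (s d)"] d unfolding dart_rel_def by auto
  qed
  show ?thesis using sub[OF pair pair'] sub[OF pair' pair] by auto
qed

text \<open>
  The boundary of a function that is constant along the dual edges avoiding a spanning tree is a
  divergence-free flow on that tree, hence zero.  So these dual edges connect all faces, and
  Euler's formula says that there are just enough of them for a spanning tree.
\<close>

lemma dimer_pair_exists:
  assumes P: "P \<subseteq> D" "bij_betw t P (t ` D - {p})" and acyc: "acyclic (dart_rel t s P)"
  shows "\<exists>Q. dimer_pair D s t l p q P Q"
proof -
  have injP: "inj_on t P" and tP: "t ` P = t ` D - {p}" using P unfolding bij_betw_def by auto
  have finP: "finite P" using P fin finite_subset by blast
  have Ps: "s d \<notin> P" if "d \<in> P" for d
  proof
    assume "s d \<in> P"
    then have "(t (s d), t d) \<in> dart_rel t s P" unfolding dart_rel_def by (auto simp: image_iff intro!: bexI[of _ "s d"])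
    moreover have "(t d, t (s d)) \<in> dart_rel t s P" using that unfolding dart_rel_def by auto
    ultimately show False using acyc unfolding acyclic_def by (meson trancl.intros)
  qed
  define R where "R = {d \<in> D. d \<notin> P \<and> s d \<notin> P}"
  have sR: "s d \<in> R" if "d \<in> R" for d using that s_in unfolding R_def by auto
  have const: "f (l d) = f (l d')"
    if f: "\<forall>d\<in>R. f (l d) = f (l (s d))" and "d \<in> D" "d' \<in> D" for f :: "'b \<Rightarrow> real" and d d'
  proof -
    define be where "be = (\<lambda>d. f (l d) - f (l (s d)))"
    have wf: "wf (dart_rel t s P)"
      using finite_acyclic_wf[OF _ acyc] finP unfolding dart_rel_def by auto
    \<comment> \<open>Leaf argument: at a vertex \<open>x\<close> of the support that no dart of the
      support in \<open>P\<close> enters, \<open>e1\<close> alone would carry flow, so the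
      divergence could not vanish.\<close>
    have beP: "be e = 0" if "e \<in> P" for e
    proof (rule ccontr)
      assume "be e \<noteq> 0"
      define X where "X = {t e |e. e \<in> P \<and> be e \<noteq> 0}"
      have "t e \<in> X" using that \<open>be e \<noteq> 0\<close> X_def by auto
      then obtain x where x: "x \<in> X" and xmin: "\<And>y. (y, x) \<in> dart_rel t s P \<Longrightarrow> y \<notin> X"
        using wf unfolding wf_eq_minimal by metis
      obtain e1 where e1: "e1 \<in> P" "be e1 \<noteq> 0" "t e1 = x" using x X_def by auto
      have "(\<Sum>d | d \<in> D \<and> t d = x. be d) = 0" unfolding be_def by (rule boundary_divergence_free)
      moreover have "(\<Sum>d | d \<in> D \<and> t d = x. be d) = be e1" if "\<And>d. d \<in> D \<Longrightarrow> t d = x \<Longrightarrow> d \<noteq> e1 \<Longrightarrow> be d = 0"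
        using that e1 P fin by (subst sum.mono_neutral_right[of _ "{e1}"]) auto
      ultimately obtain e2 where e2: "e2 \<in> D" "t e2 = x" "e2 \<noteq> e1" "be e2 \<noteq> 0" using e1(2) by auto
      have "e2 \<notin> P" using e2 e1 injP by (auto simp: inj_on_def)
      moreover have "e2 \<notin> R" using e2 f unfolding be_def by auto
      ultimately have "s e2 \<in> P" using e2 unfolding R_def by auto
      moreover have "be (s e2) \<noteq> 0" using e2(4) unfolding be_def by auto
      ultimately have "t (s e2) \<in> X" "(t (s e2), x) \<in> dart_rel t s P"
        using e2(2) unfolding X_def dart_rel_def by (auto simp: image_iff intro!: bexI[of _ "s e2"])
      then show False using xmin by blast
    qed
    have beR: "be e = 0" if "e \<in> R" for e using f that unfolding be_def by auto
    have "be e = 0" if "e \<in> D" for e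
      using that beR[of e] beP[of e] beP[of "s e"] unfolding R_def be_def by force
    then show ?thesis using dual_connected[of f d d'] that(2,3) by (auto simp: be_def)
  qed
  define Rel where "Rel = dart_rel l s R"
  obtain d0 where d0: "d0 \<in> D" "t d0 = p" "l d0 = q" using root by auto
  have reach: "(l d, q) \<in> Rel\<^sup>*" if "d \<in> D" for d
  proof -
    define f where "f = (\<lambda>u. of_bool ((u, q) \<in> Rel\<^sup>*) :: real)"
    have e: "(l e, l (s e)) \<in> Rel" if "e \<in> R" for e using that unfolding Rel_def dart_rel_def by auto
    have "\<forall>e\<in>R. f (l e) = f (l (s e))"
    proof
      fix e assume "e \<in> R"
      then have "(l e, l (s e)) \<in> Rel" "(l (s e), l e) \<in> Rel" using e[of e] e[of "s e"] sR by auto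
      then show "f (l e) = f (l (s e))" unfolding f_def by (auto intro: converse_rtrancl_into_rtrancl)
    qed
    from const[OF this that d0(1)] have "f (l d) = f q" using d0 by simp
    then show ?thesis unfolding f_def by (auto split: if_splits)
  qed
  \<comment> \<open>Distance to the root face along dual edges avoiding the tree. Giving each face a
    dart that decreases it directs the dual tree towards \<open>q\<close>, and no edge is chosen in
    both directions.\<close>
  define dist where "dist = (\<lambda>u. LEAST n. (u, q) \<in> Rel ^^ n)"
  have ex: "\<exists>d\<in>R. l d = u \<and> dist (l (s d)) < dist u" if u: "u \<in> l ` D - {q}" for u
  proof -
    have "\<exists>n. (u, q) \<in> Rel ^^ n" using reach that by (auto simp: rtrancl_power)
    then have du: "(u, q) \<in> Rel ^^ dist u" unfolding dist_def by (rule LeastI_ex)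
    then obtain m where m: "dist u = Suc m" using u by (cases "dist u") auto
    then obtain v where v: "(u, v) \<in> Rel" "(v, q) \<in> Rel ^^ m"
      using du relpow_Suc_D2[of u q m Rel] by auto
    have "dist v \<le> m" unfolding dist_def using v(2) by (rule Least_le)
    then show ?thesis using v(1) m unfolding Rel_def dart_rel_def by auto
  qed
  define g where "g = (\<lambda>u. SOME d. d \<in> R \<and> l d = u \<and> dist (l (s d)) < dist u)"
  have g: "g u \<in> R" "l (g u) = u" "dist (l (s (g u))) < dist u" if "u \<in> l ` D - {q}" for u
    using someI_ex[of "\<lambda>d. d \<in> R \<and> l d = u \<and> dist (l (s d)) < dist u"] ex[OF that] unfolding g_def by auto
  define Q where "Q = g ` (l ` D - {q})"
  have QR: "Q \<subseteq> R" using g unfolding Q_def by auto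
  have Qs: "s d \<notin> Q" if d: "d \<in> Q" for d
  proof
    assume "s d \<in> Q"
    then have "dist (l (s (s d))) < dist (l (s d))" using g unfolding Q_def by (metis imageE)
    moreover have "dist (l (s d)) < dist (l d)" using d g unfolding Q_def by (metis imageE)
    ultimately show False by simp
  qed
  have bijQ: "bij_betw l Q (l ` D - {q})"
    unfolding Q_def using g(2) by (simp add: bij_betw_def inj_on_def image_image cong: image_cong_simp)
  have double: "card (X \<union> s ` X) = 2 * card X" if "X \<subseteq> D" "\<And>d. d \<in> X \<Longrightarrow> s d \<notin> X" for X
  proof -
    have "finite X" using that(1) fin finite_subset by blast
    moreover have "card (s ` X) = card X" by (rule card_image) (metis inj_onI s_s)
    moreover have "X \<inter> s ` X = {}" using that(2) by auto
    ultimately show ?thesis by (simp add: card_Un_disjoint)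
  qed
  have "R \<subseteq> D" by (auto simp: R_def)
  have finR: "finite R" using \<open>R \<subseteq> D\<close> fin finite_subset by blast
  \<comment> \<open>The tree uses one edge fewer than there are vertices. By Euler's formula the
    remaining edges are one fewer than the faces, which is the size of \<open>Q\<close>; hence
    \<open>Q\<close> covers them all.\<close>
  have "card D = 2 * card J" using double[of J] J_sub J_disj J_cover by (metis disjoint_iff imageI)
  moreover have "D = (P \<union> s ` P) \<union> R"
    using P(1) s_in unfolding R_def by (auto simp: image_iff) (metis s_s)
  moreover have "(P \<union> s ` P) \<inter> R = {}" unfolding R_def by auto
  ultimately have cR: "2 * card J = 2 * card P + card R"
    using double[OF P(1) Ps] finP finR by (metis card_Un_disjoint finite_Un finite_imageI)
  have "p \<in> t ` D" "q \<in> l ` D" using root by auto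
  then have "card P + 1 = card (t ` D)" "card Q + 1 = card (l ` D)"
    using bij_betw_same_card[OF P(2)] bij_betw_same_card[OF bijQ] fin
      card_Suc_Diff1[of "t ` D" p] card_Suc_Diff1[of "l ` D" q] by simp_all
  then have "card R = 2 * card Q" using cR euler by simp
  then have "card (Q \<union> s ` Q) = card R" using double[of Q] Qs QR \<open>R \<subseteq> D\<close> by simp
  moreover have "Q \<union> s ` Q \<subseteq> R" using QR sR by auto
  ultimately have QsQ: "Q \<union> s ` Q = R" using finR by (simp add: card_subset_eq)
  have cover: "\<forall>d\<in>D. d \<in> P \<or> s d \<in> P \<or> d \<in> Q \<or> s d \<in> Q"
  proof
    fix d assume "d \<in> D"
    show "d \<in> P \<or> s d \<in> P \<or> d \<in> Q \<or> s d \<in> Q"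
    proof (cases "d \<in> R")
      case True then show ?thesis using QsQ by auto
    next
      case False then show ?thesis using \<open>d \<in> D\<close> unfolding R_def by auto
    qed
  qed
  have "\<forall>d\<in>P. s d \<notin> P \<and> d \<notin> Q \<and> s d \<notin> Q" using Ps QR unfolding R_def by auto
  then have "dimer_pair D s t l p q P Q"
    unfolding dimer_pair_def using P QR \<open>R \<subseteq> D\<close> bijQ Qs cover by blast
  then show ?thesis by blast
qed

end

subsection \<open>The map of \<open>G\<^sup>o\<close>\<close>

lemma uedge_eq_iff: "uedge d = uedge d' \<longleftrightarrow> d = d' \<or> d = prod.swap d'"
  by (cases d; cases d') (auto simp: uedge_def doubleton_eq_iff)

lemma uedge_swap: "uedge (prod.swap d) = uedge d"
  by (simp add: uedge_eq_iff)

lemma face_perm_altdef: "face_perm rot = rot \<circ> prod.swap"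
  by (simp add: fun_eq_iff face_perm_def)

lemma cyclic_on_image_eq:
  assumes "cyclic_on f S" shows "f ` S = S"
proof
  show "f ` S \<subseteq> S" using assms by (auto intro: cyclic_on_inI)
  show "S \<subseteq> f ` S"
  proof
    fix y assume y: "y \<in> S"
    then have S: "S = orbit f y" using assms by (simp add: cyclic_on_alldef)
    from y S have "y \<in> orbit f y" by simp
    then show "y \<in> f ` S" by (cases rule: orbit.cases) (use y S in auto)
  qed
qed

lemma funpow_closed:
  assumes "\<And>d. d \<in> D \<Longrightarrow> f d \<in> D" "x \<in> D" shows "(f ^^ n) x \<in> D"
  by (induction n) (use assms in auto)

text \<open>Since boundary walks may be infinite, a walk that arrives at the new starting dart must
  be shortened by one step; injectivity makes this possible.\<close>

lemma left_face_step:
  assumes closed: "\<And>d. d \<in> D \<Longrightarrow> face_perm rot d \<in> D" and inj: "inj_on (face_perm rot) D"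
    and d: "d \<in> D"
  shows "left_face D rot (face_perm rot d) = left_face D rot d"
proof -
  let ?f = "face_perm rot"
  have 1: "(\<exists>n. (?f ^^ n) (?f d) = d' \<or> (?f ^^ n) d' = ?f d) \<longleftrightarrow> (\<exists>n. (?f ^^ n) d = d' \<or> (?f ^^ n) d' = d)"
    if d': "d' \<in> D" for d'
  proof (intro iffI; elim exE disjE)
    fix n assume "(?f ^^ n) (?f d) = d'"
    then show "\<exists>n. (?f ^^ n) d = d' \<or> (?f ^^ n) d' = d"
      by (intro exI[of _ "Suc n"]) (simp add: funpow_swap1)
  next
    fix n assume n: "(?f ^^ n) d' = ?f d"
    show "\<exists>n. (?f ^^ n) d = d' \<or> (?f ^^ n) d' = d"
    proof (cases n)
      case 0 then show ?thesis using n by (intro exI[of _ 1]) auto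
    next
      case (Suc m)
      then have "?f ((?f ^^ m) d') = ?f d" using n by simp
      then have "(?f ^^ m) d' = d" using inj_onD[OF inj] funpow_closed[of D ?f] closed d d' by blast
      then show ?thesis by blast
    qed
  next
    fix n assume n: "(?f ^^ n) d = d'"
    show "\<exists>n. (?f ^^ n) (?f d) = d' \<or> (?f ^^ n) d' = ?f d"
    proof (cases n)
      case 0 then show ?thesis using n by (intro exI[of _ 1]) auto
    next
      case (Suc m)
      then show ?thesis using n by (intro exI[of _ m]) (simp add: funpow_swap1)
    qed
  next
    fix n assume "(?f ^^ n) d' = d"
    then show "\<exists>n. (?f ^^ n) (?f d) = d' \<or> (?f ^^ n) d' = ?f d"
      by (intro exI[of _ "Suc n"]) simp
  qed
  then show ?thesis unfolding left_face_def by blast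
qed

text \<open>\<open>None\<close> is the vertex \<open>o\<close>: outside endpoints are identified,
  while the darts still remember them and keep parallel edges apart. For infinite \<open>V\<close>
  no dart has this tail.\<close>

definition tail :: "'v set \<Rightarrow> 'v dart \<Rightarrow> 'v option" where
  "tail V d = (if fst d \<in> V then Some (fst d) else None)"

locale Go_map =
  fixes VI V :: "'v set" and E :: "'v dart set" and rot roto :: "'v dart \<Rightarrow> 'v dart"
  assumes plane: "plane_graph VI E rot"
    and cases: "infinite_case VI V \<or> finite_case VI E rot V"
    and Go: "Go_rotation E rot V roto"
begin

abbreviation "D \<equiv> Go_darts E V"
abbreviation "left \<equiv> left_face D roto"

lemma V_sub: "V \<subseteq> VI"
  using cases unfolding infinite_case_def finite_case_def by auto

lemma E_swap: "d \<in> E \<Longrightarrow> prod.swap d \<in> E"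
  using plane unfolding plane_graph_def by (cases d) (auto dest: symD)

lemma E_irrefl: "d \<in> E \<Longrightarrow> fst d \<noteq> snd d"
  using plane unfolding plane_graph_def by (cases d) (auto dest: irreflD)

lemma E_VI: "d \<in> E \<Longrightarrow> fst d \<in> VI \<and> snd d \<in> VI"
  using plane unfolding plane_graph_def by (cases d) auto

lemma finite_nbrs: "x \<in> V \<Longrightarrow> finite (nbrs E x)"
proof -
  assume "x \<in> V"
  then have "finite (out_darts E x)" using plane V_sub unfolding plane_graph_def by auto
  moreover have "nbrs E x = snd ` out_darts E x" by (force simp: nbrs_def out_darts_def)
  ultimately show ?thesis by simp
qed

lemma D_sub: "D \<subseteq> E" by (auto simp: Go_darts_def)

lemma D_swap: "d \<in> D \<Longrightarrow> prod.swap d \<in> D"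
  using E_swap by (auto simp: Go_darts_def)

lemma swap_neq: "d \<in> D \<Longrightarrow> prod.swap d \<noteq> d"
  using E_irrefl D_sub by (metis fst_swap subsetD)

lemma out_D: "x \<in> V \<Longrightarrow> out_darts E x = {d \<in> D. tail V d = Some x}"
  by (auto simp: out_darts_def Go_darts_def tail_def)

lemma finite_if_outside: "d \<in> D \<Longrightarrow> fst d \<notin> V \<Longrightarrow> finite V"
  using cases E_VI[of d] D_sub unfolding infinite_case_def finite_case_def by blast

lemma cyclic_tail:
  assumes d: "d \<in> D"
  shows "cyclic_on roto {d' \<in> D. tail V d' = tail V d}"
proof (cases "fst d \<in> V")
  case True
  have "cyclic_on rot (out_darts E (fst d))" using plane V_sub True unfolding plane_graph_def by auto
  moreover have "roto d' = rot d'" if "d' \<in> out_darts E (fst d)" for d'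
  proof -
    have "d' \<in> D" "fst d' \<in> V" using True that by (auto simp: out_darts_def Go_darts_def)
    then show ?thesis using Go unfolding Go_rotation_def by blast
  qed
  ultimately have "cyclic_on roto (out_darts E (fst d))" using cyclic_cong[of _ roto rot] by metis
  then show ?thesis using True out_D[OF True] by (simp add: tail_def)
next
  case False
  then have "cyclic_on roto {d \<in> D. fst d \<notin> V}"
    using Go finite_if_outside[OF d] unfolding Go_rotation_def by auto
  moreover have "{d' \<in> D. tail V d' = tail V d} = {d \<in> D. fst d \<notin> V}"
    using False by (auto simp: tail_def split: if_splits)
  ultimately show ?thesis by simp
qed

lemma roto_in: "d \<in> D \<Longrightarrow> roto d \<in> D" and tail_roto: "d \<in> D \<Longrightarrow> tail V (roto d) = tail V d"
  using cyclic_on_inI[OF cyclic_tail, of d d] by auto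

lemma roto_inj: "inj_on roto D"
proof (rule inj_onI)
  fix d d' assume d: "d \<in> D" "d' \<in> D" "roto d = roto d'"
  let ?S = "{e \<in> D. tail V e = tail V d}"
  have "tail V d' = tail V d" using tail_roto[OF d(1)] tail_roto[OF d(2)] d(3) by simp
  moreover have "inj_on roto ?S"
    using cyclic_on_image_eq[OF cyclic_tail] finite_cyclic_on[OF cyclic_tail] d(1)
    by (metis (no_types, lifting) eq_card_imp_inj_on)
  ultimately show "d = d'" using d by (auto dest: inj_onD)
qed

lemma tail_orbit: "\<lbrakk>d \<in> D; d' \<in> D; tail V d = tail V d'\<rbrakk> \<Longrightarrow> \<exists>n. d' = (roto ^^ n) d"
proof -
  assume d: "d \<in> D" "d' \<in> D" "tail V d = tail V d'"
  then have "d' \<in> orbit roto d" using orbit_cyclic_eq3[OF cyclic_tail[OF d(1)], of d] by auto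
  then show ?thesis by (auto simp: orbit_altdef)
qed

lemma face_perm_in: "d \<in> D \<Longrightarrow> face_perm roto d \<in> D"
  by (simp add: face_perm_def roto_in D_swap)

lemma face_perm_inj: "inj_on (face_perm roto) D"
  unfolding face_perm_def inj_on_def using roto_inj D_swap by (metis inj_onD swap_swap)

lemma left_face_perm: "d \<in> D \<Longrightarrow> left (face_perm roto d) = left d"
  by (rule left_face_step) (use face_perm_in face_perm_inj in auto)

lemma left_roto: "d \<in> D \<Longrightarrow> left (roto d) = left (prod.swap d)"
  using left_face_perm[of "prod.swap d"] D_swap by (simp add: face_perm_def)

lemma left_eq: "\<lbrakk>d \<in> D; d' \<in> left d\<rbrakk> \<Longrightarrow> d' \<in> D \<and> left d' = left d"
proof -
  have iter: "left ((face_perm roto ^^ n) e) = left e" if e: "e \<in> D" for e n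
  proof (induction n)
    case (Suc n)
    have "(face_perm roto ^^ n) e \<in> D" by (rule funpow_closed) (use face_perm_in e in auto)
    then show ?case using left_face_perm Suc by simp
  qed simp
  assume d: "d \<in> D" "d' \<in> left d"
  then obtain n where "d' \<in> D" and n: "(face_perm roto ^^ n) d = d' \<or> (face_perm roto ^^ n) d' = d"
    by (auto simp: left_face_def)
  from n have "left d' = left d"
  proof
    assume "(face_perm roto ^^ n) d = d'" then show ?thesis using iter[OF d(1), of n] by simp
  next
    assume "(face_perm roto ^^ n) d' = d" then show ?thesis using iter[OF \<open>d' \<in> D\<close>, of n] by simp
  qed
  then show ?thesis using \<open>d' \<in> D\<close> by blast
qed

lemma self_in_left: "d \<in> D \<Longrightarrow> d \<in> left d"
  unfolding left_face_def by (auto intro: exI[of _ 0])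

text \<open>On finitely many darts the face permutation has finite order, so backward iteration is
  also a forward one.\<close>

lemma left_orbit:
  assumes "finite D" "d \<in> D" "d' \<in> D" "left d = left d'"
  shows "\<exists>n. d' = (face_perm roto ^^ n) d"
proof -
  \<comment> \<open>Nothing is known about the face permutation outside \<open>D\<close>, so it is
    replaced by the identity there.\<close>
  define g where "g = perm_restrict (face_perm roto) D"
  have pow: "(g ^^ n) e = (face_perm roto ^^ n) e" if "e \<in> D" for n e
    by (induction n) (use funpow_closed[of D "face_perm roto" e] face_perm_in that in
      \<open>auto simp: g_def perm_restrict_def\<close>)
  have "bij_betw g D D"
  proof -
    have "face_perm roto ` D \<subseteq> D" using face_perm_in by auto
    then have "bij_betw (face_perm roto) D D"
      using face_perm_inj endo_inj_surj[OF \<open>finite D\<close> _ face_perm_inj]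
      by (simp add: bij_betw_def)
    then show ?thesis
      by (subst bij_betw_cong[of D g "face_perm roto"]) (simp_all add: g_def perm_restrict_def)
  qed
  then have "g permutes D" by (rule bij_imp_permutes) (simp add: g_def perm_restrict_def)
  then have g: "permutation g" using \<open>finite D\<close> permutation_permutes by blast
  have "d' \<in> left d" using self_in_left[OF assms(3)] assms(4) by simp
  then obtain n where "(g ^^ n) d = d' \<or> (g ^^ n) d' = d"
    unfolding left_face_def pow[OF assms(2)] pow[OF assms(3)] by blast
  then have "d' \<in> orbit g d"
    using orbit_altdef_permutation[OF g, of d] orbit_altdef_permutation[OF g, of d']
      permutation_self_in_orbit[OF g] orbit_swap[of d' g d] by blast
  then show ?thesis using orbit_altdef_permutation[OF g, of d] pow[OF assms(2)] by auto
qed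

end

subsection \<open>Gauge equivalence and the Gram matrix\<close>

locale weighted_Go_map = Go_map VI V E rot roto
  for VI V :: "'v set" and E :: "'v dart set" and rot roto :: "'v dart \<Rightarrow> 'v dart" +
  fixes c :: "'v \<Rightarrow> 'v \<Rightarrow> real" and mI lam :: "'v \<Rightarrow> real" and lams :: "'v face \<Rightarrow> real"
    and r :: "'v face" and ori :: "'v set \<Rightarrow> 'v dart"
  assumes conductances: "\<forall>(x, y) \<in> E. c x y > 0 \<and> c x y = c y x"
    and orientation: "\<forall>w \<in> whites E V. ori w \<in> D \<and> uedge (ori w) = w"
    and lam_pos: "\<forall>x \<in> VI. lam x > 0"
    and lam_harmonic: "\<forall>x \<in> V. massive_laplacian E c mI lam x = 0"
    and lams_pos: "\<forall>u \<in> Vstar E V roto. lams u > 0"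
begin

abbreviation "faces_r \<equiv> Vstar_red E V roto r"
abbreviation "drifted \<equiv> drifted_weight c lam"
abbreviation "killed \<equiv> killed_weight E V roto c lam lams"
abbreviation "K \<equiv> Kasteleyn E V roto r ori killed"

lemma c_pos: "d \<in> D \<Longrightarrow> c (fst d) (snd d) > 0"
  and c_sym: "d \<in> D \<Longrightarrow> c (snd d) (fst d) = c (fst d) (snd d)"
  using conductances D_sub by fastforce+

lemma lam_dart_pos: "d \<in> D \<Longrightarrow> lam (fst d) > 0" "d \<in> D \<Longrightarrow> lam (snd d) > 0"
  using lam_pos E_VI[of d] D_sub by blast+

lemma ori_cases: "d \<in> D \<Longrightarrow> ori (uedge d) = d \<or> ori (uedge d) = prod.swap d"
  using orientation uedge_eq_iff by (metis image_eqI whites_def)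

text \<open>Dual edges have drifted weight 1, so the dual killed weight itself splits into this
  factor at the crossing and \<open>inverse (lams u)\<close> at the face; the primal weights then
  require \<open>lam x\<close> at a vertex. By symmetry of \<open>c\<close> the endpoint chosen by
  \<open>ori\<close> does not matter.\<close>

definition edge_gauge :: "'v set \<Rightarrow> real" where
  "edge_gauge w = (let (x, y) = ori w in (c x y * lam x * lam y) powr (- 1/2))"

definition vertex_gauge :: "'v + 'v face \<Rightarrow> real" where
  "vertex_gauge b = (case b of Inl x \<Rightarrow> lam x | Inr u \<Rightarrow> inverse (lams u))"

lemma edge_gauge_uedge:
  assumes "d \<in> D"
  shows "edge_gauge (uedge d) = (c (fst d) (snd d) * lam (fst d) * lam (snd d)) powr (- 1/2)"
  using ori_cases[OF assms] c_sym[OF assms]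
  by (auto simp: edge_gauge_def Let_def case_prod_beta mult_ac)

lemma powr_half_quotient:
  assumes "b > 0" "x > (0 :: real)"
  shows "b powr (1/2) * x powr (- 1/2) = (b / x) powr (1/2)"
  using assms by (simp add: powr_divide powr_minus_divide)

lemma powr_half_gauge:
  assumes "a > 0" "x > (0 :: real)" "y > 0"
  shows "(a * y / x) powr (1/2) = (a * x * y) powr (- 1/2) * (a * y / x) * x"
proof -
  define b where "b = a * y"
  have b: "b > 0" using assms by (simp add: b_def)
  have "(b * x) powr (- 1/2) * b = x powr (- 1/2) * (b powr (- 1/2) * b powr 1)"
    using b assms by (simp add: powr_mult)
  also have "b powr (- 1/2) * b powr 1 = b powr (1/2)"
    unfolding powr_add[symmetric] by simp
  also have "x powr (- 1/2) * b powr (1/2) = (b / x) powr (1/2)"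
    using powr_half_quotient[OF b, of x] assms by (simp only: mult.commute)
  finally show ?thesis using assms by (simp add: b_def mult_ac)
qed

lemma killed_gauge:
  assumes "e \<in> dedges E V roto r"
  shows "killed e = edge_gauge (white_end e) * drifted e * vertex_gauge (black_end E V roto e)"
proof (cases e)
  case (Primal d)
  then have "d \<in> D" using assms by (auto simp: dedges_def)
  then show ?thesis
    using Primal edge_gauge_uedge[of d] powr_half_gauge[OF c_pos lam_dart_pos, of d d d]
    by (simp add: vertex_gauge_def)
next
  case (Dual d)
  then have "d \<in> D" using assms by (auto simp: dedges_def)
  then show ?thesis using Dual edge_gauge_uedge[of d] by (simp add: vertex_gauge_def)
qed

text \<open>The gauge factors depend only on the two ends of an edge and therefore pass through the
  sum over parallel edges.\<close>

lemma gauge_equivalent: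
  "K w b = complex_of_real (edge_gauge w) * Kasteleyn E V roto r ori drifted w b
     * complex_of_real (vertex_gauge b)"
  unfolding Kasteleyn_def sum_distrib_left sum_distrib_right
  by (intro sum.cong refl) (auto simp: killed_gauge mult_ac)

lemma edge_gauge_pos: "w \<in> whites E V \<Longrightarrow> edge_gauge w > 0"
proof -
  assume "w \<in> whites E V"
  then obtain d where "d \<in> D" "w = uedge d" by (auto simp: whites_def)
  then show ?thesis using edge_gauge_uedge[of d] c_pos[of d] lam_dart_pos[of d] by simp
qed

lemma vertex_gauge_pos: "b \<in> blacks E V roto r \<Longrightarrow> vertex_gauge b > 0"
  using V_sub lam_pos lams_pos by (auto simp: blacks_def vertex_gauge_def Vstar_red_def)

section \<open>Entries of the killed Kasteleyn matrix and of its Gram matrix\<close>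

lemma K_primal:
  assumes "d \<in> D" "fst d \<in> V"
  shows "K (uedge d) (Inl (fst d)) = phase ori (Primal d) * complex_of_real (killed (Primal d))"
proof -
  have "{e \<in> dedges E V roto r. white_end e = uedge d \<and> black_end E V roto e = Inl (fst d)} = {Primal d}"
    using assms E_irrefl[of d] D_sub
    by (cases d) (auto simp: dedges_def blacks_def uedge_eq_iff)
  then show ?thesis unfolding Kasteleyn_def by simp
qed

lemma K_primal_eq_0: "x \<notin> w \<Longrightarrow> K w (Inl x) = 0"
proof -
  assume "x \<notin> w"
  then have "{e \<in> dedges E V roto r. white_end e = w \<and> black_end E V roto e = Inl x} = {}"
    by (auto simp: dedges_def uedge_def)
  then show ?thesis unfolding Kasteleyn_def by (metis sum.empty)
qed

text \<open>The two dual edges at a crossing have opposite phases, whence the difference of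
  indicators. If the same face lies on both sides, the parallel edges cancel.\<close>

lemma K_dual:
  assumes "d \<in> D" "u \<in> faces_r"
  shows "K (uedge d) (Inr u) = phase ori (Dual d) * complex_of_real (edge_gauge (uedge d) / lams u)
     * (of_bool (left d = u) - of_bool (left (prod.swap d) = u))"
proof -
  let ?S = "{e \<in> dedges E V roto r. white_end e = uedge d \<and> black_end E V roto e = Inr u}"
  have S: "?S = Dual ` {d' \<in> {d, prod.swap d}. left d' = u}"
    using assms D_swap[OF assms(1)] by (cases d) (auto simp: dedges_def blacks_def uedge_eq_iff, auto simp: uedge_def)
  have "uedge (prod.swap d) = uedge d" by (simp add: uedge_eq_iff)
  then have ph: "phase ori (Dual (prod.swap d)) = - phase ori (Dual d)"
    using ori_cases[OF assms(1)] swap_neq[OF assms(1)] by (elim disjE) simp_all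
  have kd: "killed (Dual d) = edge_gauge (uedge d) / lams (left d)"
    unfolding edge_gauge_uedge[OF assms(1)] killed_weight.simps by (simp only: divide_inverse mult.commute)
  have ks: "killed (Dual (prod.swap d)) = edge_gauge (uedge d) / lams (left (prod.swap d))"
    unfolding edge_gauge_uedge[OF assms(1)] killed_weight.simps
    by (simp only: divide_inverse mult_ac fst_swap snd_swap c_sym[OF assms(1)])
  have "K (uedge d) (Inr u) = (\<Sum>d' | d' \<in> {d, prod.swap d} \<and> left d' = u.
      phase ori (Dual d') * complex_of_real (killed (Dual d')))"
    unfolding Kasteleyn_def S by (subst sum.reindex) (auto simp: inj_on_def)
  also have "\<dots> = (\<Sum>d'\<in>{d, prod.swap d}. if left d' = u
      then phase ori (Dual d') * complex_of_real (killed (Dual d')) else 0)"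
    by (subst sum.inter_filter) auto
  also have "\<dots> = (if left d = u then phase ori (Dual d) * complex_of_real (killed (Dual d)) else 0) +
      (if left (prod.swap d) = u then - phase ori (Dual d) * complex_of_real (killed (Dual (prod.swap d))) else 0)"
    using swap_neq[OF assms(1)] ph by simp
  finally show ?thesis unfolding kd ks by (auto simp: algebra_simps)
qed

text \<open>The column of \<open>x\<close> is supported on the finitely many edges at
  \<open>x\<close>, so the possibly infinite sum is a finite one.\<close>

lemma gram_primal:
  assumes x: "x \<in> V"
  shows "gram (whites E V) K (Inl x) b =
    (\<Sum>d\<in>out_darts E x. cnj (K (uedge d) (Inl x)) * K (uedge d) b)"
proof -
  have out: "out_darts E x \<subseteq> D" using x by (auto simp: out_darts_def Go_darts_def)
  have fin: "finite (out_darts E x)" using plane V_sub x unfolding plane_graph_def by auto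
  have "gram (whites E V) K (Inl x) b =
      (\<Sum>\<^sub>\<infinity>w\<in>uedge ` out_darts E x. cnj (K w (Inl x)) * K w b)"
    unfolding gram_def
  proof (rule infsum_cong_neutral)
    fix w assume w: "w \<in> whites E V - uedge ` out_darts E x"
    have "x \<notin> w"
    proof
      assume "x \<in> w"
      obtain d where d: "d \<in> D" "w = uedge d" using w by (auto simp: whites_def)
      then consider "fst d = x" | "snd d = x" using \<open>x \<in> w\<close> by (auto simp: uedge_def)
      then show False
      proof cases
        case 1 then show ?thesis using w d D_sub by (auto simp: out_darts_def)
      next
        case 2
        then have "prod.swap d \<in> out_darts E x"
          using D_swap[OF d(1)] D_sub unfolding out_darts_def by (cases d) auto
        then show ?thesis using w d uedge_eq_iff by (metis DiffD2 image_eqI)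
      qed
    qed
    then show "cnj (K w (Inl x)) * K w b = 0" by (simp add: K_primal_eq_0)
  qed (use out in \<open>auto simp: whites_def\<close>)
  also have "\<dots> = (\<Sum>w\<in>uedge ` out_darts E x. cnj (K w (Inl x)) * K w b)"
    using fin by (simp add: infsum_finite)
  also have "\<dots> = (\<Sum>d\<in>out_darts E x. cnj (K (uedge d) (Inl x)) * K (uedge d) b)"
  proof (subst sum.reindex)
    show "inj_on uedge (out_darts E x)"
      using E_irrefl by (fastforce simp: inj_on_def uedge_eq_iff out_darts_def)
  qed simp
  finally show ?thesis .
qed

lemma sum_out_darts: "(\<Sum>d\<in>out_darts E x. f d) = (\<Sum>y\<in>nbrs E x. f (x, y))"
  by (rule sum.reindex_bij_witness[of _ "\<lambda>y. (x, y)" snd]) (auto simp: out_darts_def nbrs_def)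

text \<open>Harmonicity divided by \<open>lam x\<close>: the total drifted conductance at
  \<open>x\<close> equals the diagonal entry of the massive Laplacian.\<close>

lemma harmonic_sum:
  assumes "x \<in> V"
  shows "(\<Sum>y\<in>nbrs E x. c x y * lam y / lam x) = mI x + (\<Sum>y\<in>nbrs E x. c x y)"
proof -
  have l: "lam x > 0" using assms V_sub lam_pos by auto
  have "mI x * lam x + (\<Sum>y\<in>nbrs E x. c x y * (lam x - lam y)) = 0"
    using lam_harmonic assms by (simp add: massive_laplacian_def)
  then have "(\<Sum>y\<in>nbrs E x. c x y * lam y) = (mI x + (\<Sum>y\<in>nbrs E x. c x y)) * lam x"
    by (simp add: right_diff_distrib sum_subtractf sum_distrib_right[symmetric] distrib_right)
  then show ?thesis using l by (simp add: sum_divide_distrib[symmetric])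
qed

lemma phase_primal_square: "cnj (phase ori (Primal d)) * phase ori (Primal d) = 1"
  by simp

text \<open>Squared killed weights are drifted conductances, so the diagonal is
  \<open>harmonic_sum\<close>. For adjacent vertices only their common edge contributes: the
  quotients of \<open>lam\<close> cancel and the opposite phases give the minus sign.\<close>

lemma gram_primal_primal:
  assumes x: "x \<in> V" and y: "y \<in> V"
  shows "gram (whites E V) K (Inl x) (Inl y) = complex_of_real (laplacian_matrix E c mI x y)"
proof -
  have out: "d \<in> D" "fst d = x" if "d \<in> out_darts E x" for d
    using that x by (auto simp: out_darts_def Go_darts_def)
  have nb: "(x, z) \<in> D" "z \<noteq> x" if "z \<in> nbrs E x" for z
    using that x E_irrefl[of "(x, z)"] by (auto simp: nbrs_def Go_darts_def)
  show ?thesis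
  proof (cases "y = x")
    case True
    have "gram (whites E V) K (Inl x) (Inl x) = (\<Sum>z\<in>nbrs E x. complex_of_real (c x z * lam z / lam x))"
      unfolding gram_primal[OF x] sum_out_darts
    proof (rule sum.cong)
      fix z assume z: "z \<in> nbrs E x"
      have "complex_of_real (killed (Primal (x, z))) * complex_of_real (killed (Primal (x, z))) =
          complex_of_real (c x z * lam z / lam x)"
        using c_pos[OF nb(1)[OF z]] lam_dart_pos[OF nb(1)[OF z]]
        by (simp add: of_real_mult[symmetric] powr_add[symmetric] del: of_real_mult of_real_divide)
      moreover have "K (uedge (x, z)) (Inl x) = phase ori (Primal (x, z)) * complex_of_real (killed (Primal (x, z)))"
        using K_primal[OF nb(1)[OF z]] x by simp
      ultimately show "cnj (K (uedge (x, z)) (Inl x)) * K (uedge (x, z)) (Inl x) =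
          complex_of_real (c x z * lam z / lam x)"
        using phase_primal_square[of "(x, z)"] by (simp del: killed_weight.simps phase.simps add: mult_ac)
    qed simp
    also have "\<dots> = complex_of_real (mI x + (\<Sum>y\<in>nbrs E x. c x y))"
      using harmonic_sum[OF x] by (metis of_real_sum)
    also have "mI x + (\<Sum>y\<in>nbrs E x. c x y) = laplacian_matrix E c mI x x"
      using nb(2) by (simp add: laplacian_matrix_def massive_laplacian_def)
    finally show ?thesis using True by simp
  next
    case False
    have "gram (whites E V) K (Inl x) (Inl y) = (\<Sum>z\<in>nbrs E x. if z = y then - complex_of_real (c x y) else 0)"
      unfolding gram_primal[OF x] sum_out_darts
    proof (rule sum.cong)
      fix z assume z: "z \<in> nbrs E x"
      show "cnj (K (uedge (x, z)) (Inl x)) * K (uedge (x, z)) (Inl y) =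
          (if z = y then - complex_of_real (c x y) else 0)"
      proof (cases "z = y")
        case True
        have d: "(x, y) \<in> D" "(y, x) \<in> D" using nb(1)[OF z] D_swap True by force+
        have "uedge (x, y) = uedge (y, x)" by (auto simp: uedge_def)
        then have K: "K (uedge (x, y)) (Inl x) = phase ori (Primal (x, y)) * complex_of_real (killed (Primal (x, y)))"
          "K (uedge (x, y)) (Inl y) = phase ori (Primal (y, x)) * complex_of_real (killed (Primal (y, x)))"
          using K_primal[OF d(1)] K_primal[OF d(2)] x y by simp_all
        have ph: "cnj (phase ori (Primal (x, y))) * phase ori (Primal (y, x)) = - 1"
          using ori_cases[OF d(1)] False \<open>uedge (x, y) = uedge (y, x)\<close> by auto
        have "killed (Primal (x, y)) * killed (Primal (y, x)) = c x y"
        proof -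
          have "killed (Primal (x, y)) * killed (Primal (y, x)) =
              (c x y * lam y / lam x * (c x y * lam x / lam y)) powr (1/2)"
            using c_sym[OF d(1)] c_pos[OF d(1)] lam_dart_pos[OF d(1)] by (simp add: powr_mult[symmetric])
          also have "c x y * lam y / lam x * (c x y * lam x / lam y) = c x y * c x y"
            using lam_dart_pos[OF d(1)] by simp
          finally show ?thesis using c_pos[OF d(1)] by (simp add: powr_half_sqrt)
        qed
        then have "complex_of_real (killed (Primal (x, y))) * complex_of_real (killed (Primal (y, x))) = complex_of_real (c x y)"
          by (metis of_real_mult)
        then have "cnj (K (uedge (x, y)) (Inl x)) * K (uedge (x, y)) (Inl y) = - complex_of_real (c x y)"
          unfolding K using ph
          by (simp del: killed_weight.simps phase.simps add: mult.assoc)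
             (metis (no_types, lifting) mult.assoc mult.commute mult_minus1)
        then show ?thesis using True by simp
      next
        case zy: False
        then have "y \<notin> uedge (x, z)" using False by (simp add: uedge_def)
        then show ?thesis using zy by (simp add: K_primal_eq_0)
      qed
    qed simp
    also have "\<dots> = complex_of_real (laplacian_matrix E c mI x y)"
      using False finite_nbrs[OF x]
      by (simp add: laplacian_matrix_def massive_laplacian_def sum_negf if_distrib[of "(*) _"]
          if_distrib[of uminus] sum.delta cong: if_cong)
    finally show ?thesis .
  qed
qed

text \<open>
  Across an edge the two moduli multiply to a constant and the phases to \<open>\<i>\<close>, so the sum
  around a vertex telescopes.
\<close>

lemma gram_primal_dual:
  assumes x: "x \<in> V" and u: "u \<in> faces_r"
  shows "gram (whites E V) K (Inl x) (Inr u) = 0"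
proof -
  let ?S = "out_darts E x"
  let ?L = "\<lambda>d. of_bool (left d = u) :: complex"
  have S: "?S = {d \<in> D. tail V d = Some x}" by (rule out_D[OF x])
  have each: "cnj (K (uedge d) (Inl x)) * K (uedge d) (Inr u) =
      \<i> * complex_of_real (inverse (lam x * lams u)) * (?L d - ?L (prod.swap d))" if "d \<in> ?S" for d
  proof -
    have d: "d \<in> D" "fst d = x" using that x by (auto simp: out_darts_def Go_darts_def)
    have "killed (Primal d) * edge_gauge (uedge d) = inverse (lam x)"
    proof -
      have "killed (Primal d) * edge_gauge (uedge d) =
          ((c x (snd d) * lam (snd d) / lam x) / (c x (snd d) * lam x * lam (snd d))) powr (1/2)"
        unfolding edge_gauge_uedge[OF d(1)] using d(2) c_pos[OF d(1)] lam_dart_pos[OF d(1)]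
        by (subst powr_half_quotient[symmetric]) auto
      also have "(c x (snd d) * lam (snd d) / lam x) / (c x (snd d) * lam x * lam (snd d)) = inverse (lam x) * inverse (lam x)"
        using d(2) c_pos[OF d(1)] lam_dart_pos[OF d(1)] by (simp add: field_simps)
      finally show ?thesis using d(2) lam_dart_pos(1)[OF d(1)] by (simp add: powr_half_sqrt)
    qed
    then have mod: "complex_of_real (killed (Primal d)) * complex_of_real (edge_gauge (uedge d) / lams u) =
        complex_of_real (inverse (lam x * lams u))"
      by (simp add: divide_inverse mult.assoc[symmetric] del: killed_weight.simps flip: of_real_mult)
    have ph: "cnj (phase ori (Primal d)) * phase ori (Dual d) = \<i>" by simp
    have "cnj (K (uedge d) (Inl x)) * K (uedge d) (Inr u) =
      (cnj (phase ori (Primal d)) * phase ori (Dual d)) *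
      (complex_of_real (killed (Primal d)) * complex_of_real (edge_gauge (uedge d) / lams u)) * (?L d - ?L (prod.swap d))"
      using K_primal[of d] d x K_dual[OF d(1) u] by (simp del: killed_weight.simps phase.simps add: mult_ac)
    then show ?thesis unfolding mod ph .
  qed
  have "gram (whites E V) K (Inl x) (Inr u) =
      \<i> * complex_of_real (inverse (lam x * lams u)) * (\<Sum>d\<in>?S. ?L d - ?L (prod.swap d))"
    unfolding gram_primal[OF x] sum_distrib_left by (intro sum.cong each) auto
  also have "(\<Sum>d\<in>?S. ?L (prod.swap d)) = (\<Sum>d\<in>?S. ?L (roto d))"
    by (rule sum.cong) (auto simp: S left_roto)
  then have "(\<Sum>d\<in>?S. ?L d - ?L (prod.swap d)) = (\<Sum>d\<in>?S. ?L d) - (\<Sum>d\<in>?S. ?L (roto d))"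
    by (simp add: sum_subtractf)
  also have "(\<Sum>d\<in>?S. ?L (roto d)) = (\<Sum>d\<in>?S. ?L d)"
  proof (rule sum.reindex_bij_betw)
    show "bij_betw roto ?S ?S"
    proof (cases "?S = {}")
      case False
      then obtain d where "d \<in> D" "tail V d = Some x" using S by auto
      then have "roto ` ?S = ?S" using cyclic_on_image_eq[OF cyclic_tail[of d]] S by simp
      then show ?thesis using roto_inj S by (auto simp: bij_betw_def intro: inj_on_subset)
    qed (simp add: bij_betw_def)
  qed
  finally show ?thesis by simp
qed

lemma gram_cnj: "gram W M b' b = cnj (gram W M b b')"
  unfolding gram_def by (subst infsum_cnj[symmetric]) (simp add: mult.commute)

text \<open>The dual block is taken to be whatever the Gram matrix has there; the content lies in
  the primal block and the mixed block, whose conjugate is the other mixed one.\<close>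

lemma gram_block_diag:
  assumes "b \<in> blacks E V roto r" "b' \<in> blacks E V roto r"
  shows "gram (whites E V) K b b' =
    block_diag (\<lambda>x y. complex_of_real (laplacian_matrix E c mI x y))
      (\<lambda>u v. gram (whites E V) K (Inr u) (Inr v)) b b'"
proof -
  have "gram (whites E V) K (Inr u) (Inl x) = 0" if "x \<in> V" "u \<in> faces_r" for x u
    using gram_cnj[of "whites E V" K "Inr u" "Inl x"] gram_primal_dual[OF that] by simp
  then show ?thesis
    using assms gram_primal_primal gram_primal_dual by (cases b; cases b') (auto simp: blacks_def)
qed

end

subsection \<open>Temperley's bijection\<close>

lemma (in Go_map) finite_D:
  assumes "finite V" shows "finite D"
proof -
  have "finite (\<Union>x\<in>V. out_darts E x)"
    using plane V_sub assms unfolding plane_graph_def by auto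
  moreover have "D \<subseteq> (\<Union>x\<in>V. out_darts E x) \<union> prod.swap ` (\<Union>x\<in>V. out_darts E x)"
  proof
    fix d assume d: "d \<in> D"
    then consider "fst d \<in> V" | "snd d \<in> V" by (auto simp: Go_darts_def)
    then show "d \<in> (\<Union>x\<in>V. out_darts E x) \<union> prod.swap ` (\<Union>x\<in>V. out_darts E x)"
    proof cases
      case 1 then show ?thesis using d D_sub by (auto simp: out_darts_def)
    next
      case 2
      then have "prod.swap d \<in> out_darts E (snd d)" using d D_swap D_sub by (cases d) (auto simp: out_darts_def)
      then have "d \<in> prod.swap ` out_darts E (snd d)" by (metis image_eqI swap_swap)
      then show ?thesis using 2 by blast
    qed
  qed
  ultimately show ?thesis using finite_subset by blast
qed

text \<open>An ambient path survives the identification of all outside vertices with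
  \<open>o\<close>: an edge with both ends outside becomes a constant step.\<close>

lemma (in Go_map) tail_connected:
  assumes h: "\<forall>d\<in>D. h (tail V d) = h (tail V (prod.swap d))" and d: "d \<in> D" "d' \<in> D"
  shows "h (tail V d) = h (tail V d')"
proof -
  define H where "H = (\<lambda>x. h (if x \<in> V then Some x else None))"
  have edge: "H x = H y" if "(x, y) \<in> E" for x y
  proof (cases "x \<in> V \<or> y \<in> V")
    case True
    then have "(x, y) \<in> D" using that by (auto simp: Go_darts_def)
    then show ?thesis using h by (force simp: H_def tail_def)
  qed (simp add: H_def)
  have "H x = H y" if "(x, y) \<in> E\<^sup>*" for x y
    using that by (induction rule: rtrancl_induct) (auto simp: edge)
  moreover have "(fst d, fst d') \<in> E\<^sup>*"
    using plane d D_sub E_VI unfolding plane_graph_def connected_graph_def by blast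
  ultimately show ?thesis by (simp add: H_def tail_def)
qed

locale finite_Go_map = weighted_Go_map VI V E rot roto c mI lam lams r ori
  for VI V :: "'v set" and E :: "'v dart set" and rot roto c mI lam lams r ori +
  assumes finV: "finite V" and root_face: "r \<in> Vstar E V roto" and root_o: "incident_o V r"
begin

lemma root_dart: "\<exists>d\<in>D. tail V d = None \<and> left d = r"
proof -
  obtain d0 where d0: "d0 \<in> D" "r = left d0" using root_face by (auto simp: Vstar_def faces_def)
  obtain d where d: "d \<in> r" "fst d \<notin> V" using root_o by (auto simp: incident_o_def)
  then have "d \<in> D" "left d = r" using left_eq[OF d0(1), of d] d0(2) by auto
  then show ?thesis using d(2) by (auto simp: tail_def)
qed

lemma V_proper: "V \<subset> VI"
  using cases finV unfolding infinite_case_def finite_case_def by auto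

text \<open>Properness of \<open>V\<close> covers the case of a single vertex, all of whose edges
  lead to \<open>o\<close>.\<close>

lemma has_nbr: "x \<in> V \<Longrightarrow> \<exists>y. (x, y) \<in> D"
proof -
  assume x: "x \<in> V"
  obtain z where z: "z \<in> VI" "z \<noteq> x" using V_proper x by blast
  then have "(x, z) \<in> E\<^sup>*" using plane V_sub x unfolding plane_graph_def connected_graph_def by auto
  then obtain y where "(x, y) \<in> E" using z(2) by (metis converse_rtranclE)
  then show ?thesis using x by (auto simp: Go_darts_def)
qed

lemma tails: "tail V ` D = insert None (Some ` V)"
proof
  show "tail V ` D \<subseteq> insert None (Some ` V)" by (auto simp: tail_def)
  have "None \<in> tail V ` D" using root_dart by force
  moreover have "Some x \<in> tail V ` D" if "x \<in> V" for x
    using has_nbr[OF that] that by (force simp: tail_def)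
  ultimately show "insert None (Some ` V) \<subseteq> tail V ` D" by auto
qed

text \<open>The phase convention \<open>ori\<close> doubles as the choice of one dart per edge, and
  Euler's formula is the genus condition on \<open>roto\<close>, with \<open>o\<close> counted as a
  vertex.\<close>

sublocale sphere: spherical_map D "ori ` whites E V" prod.swap roto "tail V" left None r
proof unfold_locales
  have ori: "ori w \<in> D" "uedge (ori w) = w" if "w \<in> whites E V" for w
    using orientation that by auto
  show "ori ` whites E V \<subseteq> D" using ori by auto
  show "ori ` whites E V \<union> prod.swap ` ori ` whites E V = D"
  proof
    show "ori ` whites E V \<union> prod.swap ` ori ` whites E V \<subseteq> D"
      unfolding image_image by (intro Un_least image_subsetI ori(1) D_swap)
    show "D \<subseteq> ori ` whites E V \<union> prod.swap ` ori ` whites E V"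
    proof
      fix d assume d: "d \<in> D"
      then have "uedge d \<in> whites E V" by (auto simp: whites_def)
      moreover have "d = ori (uedge d) \<or> d = prod.swap (ori (uedge d))"
        using ori_cases[OF d] by (metis swap_swap)
      ultimately show "d \<in> ori ` whites E V \<union> prod.swap ` ori ` whites E V" by blast
    qed
  qed
  show "ori ` whites E V \<inter> prod.swap ` ori ` whites E V = {}"
  proof (rule ccontr)
    assume "ori ` whites E V \<inter> prod.swap ` ori ` whites E V \<noteq> {}"
    then obtain w w' where w: "w \<in> whites E V" "w' \<in> whites E V" "ori w = prod.swap (ori w')" by blast
    then have "uedge (ori w) = uedge (ori w')" by (simp add: uedge_eq_iff)
    then have "w = w'" using ori(2) w(1,2) by metis
    then show False using w swap_neq ori by metis
  qed
  show "\<exists>n. d' = ((roto \<circ> prod.swap) ^^ n) d" if "d \<in> D" "d' \<in> D" "left d = left d'" for d d'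
    using left_orbit[OF finite_D[OF finV] that] by (simp add: face_perm_altdef)
  show "h (tail V d) = (h (tail V d') :: real)"
    if "\<forall>d\<in>D. h (tail V d) = h (tail V (prod.swap d))" "d \<in> D" "d' \<in> D" for h d d'
    using tail_connected[of h] that by blast
  have "card (tail V ` D) = card V + 1"
    unfolding tails using finV by (simp add: card_image)
  moreover have "card (ori ` whites E V) = card (uedge ` D)"
    unfolding whites_def[symmetric] by (rule card_image) (metis inj_onI ori(2))
  moreover have "card V + 1 + card (left ` D) = card (uedge ` D) + 2"
    using Go finV by (simp add: Go_rotation_def genus_zero_def faces_def)
  ultimately show "card (tail V ` D) + card (left ` D) = card (ori ` whites E V) + 2" by simp
qed (use finite_D[OF finV] D_swap roto_in roto_inj tail_roto left_roto tail_orbit root_dart in auto)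

section \<open>Dimer configurations as dimer pairs\<close>

abbreviation "pair \<equiv> dimer_pair D prod.swap (tail V) left None r"
abbreviation "graph f \<equiv> (\<lambda>x. (x, f x)) ` V"

lemma dimer_configs_iff:
  "M \<in> dimer_configs E V roto r \<longleftrightarrow> (\<exists>P Q. pair P Q \<and> M = Primal ` P \<union> Dual ` Q)"
proof
  assume M: "M \<in> dimer_configs E V roto r"
  define P where "P = {d. Primal d \<in> M}"
  define Q where "Q = {d. Dual d \<in> M}"
  have MPQ: "M = Primal ` P \<union> Dual ` Q"
  proof (rule Set.set_eqI)
    show "e \<in> M \<longleftrightarrow> e \<in> Primal ` P \<union> Dual ` Q" for e
      unfolding P_def Q_def by (cases e) auto
  qed
  have sub: "M \<subseteq> dedges E V roto r" using M by (simp add: dimer_configs_def)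
  have P: "d \<in> D" "fst d \<in> V" if "d \<in> P" for d
    using that sub unfolding P_def by (auto simp: dedges_def blacks_def)
  have Q: "d \<in> D" "left d \<in> left ` D - {r}" if "d \<in> Q" for d
    using that sub finV unfolding Q_def
    by (auto simp: dedges_def blacks_def Vstar_red_def Vstar_def faces_def)
  have black: "\<exists>!e. e \<in> M \<and> black_end E V roto e = b" if "b \<in> blacks E V roto r" for b
    using M that by (simp add: dimer_configs_def)
  have edge: "\<exists>!e. e \<in> M \<and> white_end e = uedge d" if "d \<in> D" for d
    using M that by (simp add: dimer_configs_def whites_def)
  have white: "e = e'" if "e \<in> M" "e' \<in> M" "white_end e = uedge d" "white_end e' = uedge d" "d \<in> D" for e e' d
    using edge[OF that(5)] that(1-4) by blast
  have "bij_betw (tail V) P (Some ` V)"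
    unfolding bij_betw_def
  proof
    show "inj_on (tail V) P"
    proof (rule inj_onI)
      fix d d' assume d: "d \<in> P" "d' \<in> P" "tail V d = tail V d'"
      then have "fst d = fst d'" using P by (simp add: tail_def)
      moreover have "Inl (fst d) \<in> blacks E V roto r" using P(2)[OF d(1)] by (auto simp: blacks_def)
      ultimately have "Primal d = Primal d'"
        using black[of "Inl (fst d)"] d unfolding P_def by (metis black_end.simps(1) mem_Collect_eq)
      then show "d = d'" by simp
    qed
    have "Some x \<in> tail V ` P" if "x \<in> V" for x
    proof -
      have "Inl x \<in> blacks E V roto r" using that by (auto simp: blacks_def)
      then obtain e where e: "e \<in> M" "black_end E V roto e = Inl x" using black by blast
      then obtain d where "e = Primal d" "fst d = x" by (cases e) auto
      then show ?thesis using e that unfolding P_def by (force simp: tail_def)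
    qed
    then show "tail V ` P = Some ` V" using P by (auto simp: tail_def)
  qed
  moreover have "bij_betw left Q (left ` D - {r})"
    unfolding bij_betw_def
  proof
    have blk: "Inr u \<in> blacks E V roto r \<longleftrightarrow> u \<in> left ` D - {r}" for u
      using finV by (auto simp: blacks_def Vstar_red_def Vstar_def faces_def)
    show "inj_on left Q"
    proof (rule inj_onI)
      fix d d' assume d: "d \<in> Q" "d' \<in> Q" "left d = left d'"
      then have "Dual d = Dual d'"
        using black[of "Inr (left d)"] Q(2)[OF d(1)] blk unfolding Q_def
        by (metis black_end.simps(2) mem_Collect_eq)
      then show "d = d'" by simp
    qed
    have "u \<in> left ` Q" if "u \<in> left ` D - {r}" for u
    proof -
      have "Inr u \<in> blacks E V roto r" using blk that by simp
      from black[OF this] obtain e where e: "e \<in> M" "black_end E V roto e = Inr u" by blast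
      then obtain d where "e = Dual d" "left d = u" by (cases e) auto
      then show ?thesis using e unfolding Q_def by auto
    qed
    then show "left ` Q = left ` D - {r}" using Q by blast
  qed
  moreover have "prod.swap d \<notin> P \<and> d \<notin> Q \<and> prod.swap d \<notin> Q" if d: "d \<in> P" for d
  proof -
    have M: "Primal d \<in> M" using d by (simp add: P_def)
    have eq: "e = Primal d" if "e \<in> M" "white_end e = uedge d" for e
      by (rule white[OF that(1) M that(2) _ P(1)[OF d]]) simp
    show ?thesis
      using eq[of "Primal (prod.swap d)"] eq[of "Dual d"] eq[of "Dual (prod.swap d)"] swap_neq[OF P(1)[OF d]]
      unfolding P_def Q_def mem_Collect_eq white_end.simps uedge_swap by blast
  qed
  moreover have "prod.swap d \<notin> Q" if d: "d \<in> Q" for d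
  proof
    assume "prod.swap d \<in> Q"
    then have "Dual (prod.swap d) = Dual d"
      using d by (intro white[of _ _ d]) (simp_all add: Q_def uedge_swap Q(1)[OF d])
    then show False using swap_neq[OF Q(1)[OF d]] by simp
  qed
  moreover have "d \<in> P \<or> prod.swap d \<in> P \<or> d \<in> Q \<or> prod.swap d \<in> Q" if d: "d \<in> D" for d
  proof -
    from edge[OF d] obtain e where e: "e \<in> M" "white_end e = uedge d" by blast
    show ?thesis
    proof (cases e)
      case (Primal d')
      then have "d' \<in> P" "uedge d' = uedge d" using e by (simp_all add: P_def)
      then show ?thesis unfolding uedge_eq_iff by (elim disjE) simp_all
    next
      case (Dual d')
      then have "d' \<in> Q" "uedge d' = uedge d" using e by (simp_all add: Q_def)
      then show ?thesis unfolding uedge_eq_iff by (elim disjE) simp_all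
    qed
  qed
  moreover have "P \<subseteq> D" "Q \<subseteq> D" using P(1) Q(1) by blast+
  moreover have "tail V ` D - {None} = Some ` V" unfolding tails by auto
  ultimately have "pair P Q" unfolding dimer_pair_def by simp
  then show "\<exists>P Q. pair P Q \<and> M = Primal ` P \<union> Dual ` Q" using MPQ by blast
next
  assume "\<exists>P Q. pair P Q \<and> M = Primal ` P \<union> Dual ` Q"
  then obtain P Q where pr: "pair P Q" and M: "M = Primal ` P \<union> Dual ` Q" by auto
  have sub: "P \<subseteq> D" "Q \<subseteq> D" using pr by (auto simp: dimer_pair_def)
  have bP: "inj_on (tail V) P" "tail V ` P = Some ` V"
    using pr by (auto simp: dimer_pair_def tails bij_betw_def)
  have bQ: "inj_on left Q" "left ` Q = left ` D - {r}"
    using pr by (auto simp: dimer_pair_def bij_betw_def)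
  have PV: "fst d \<in> V" if "d \<in> P" for d
  proof -
    have "tail V d \<in> Some ` V" using bP(2) that by blast
    then show ?thesis by (auto simp: tail_def split: if_splits)
  qed
  have blk: "Vstar_red E V roto r = left ` D - {r}"
    using finV by (auto simp: Vstar_red_def Vstar_def faces_def)
  have M_iff: "Primal d \<in> M \<longleftrightarrow> d \<in> P" "Dual d \<in> M \<longleftrightarrow> d \<in> Q" for d by (auto simp: M)
  have "M \<subseteq> dedges E V roto r"
  proof
    fix e assume e: "e \<in> M"
    show "e \<in> dedges E V roto r"
    proof (cases e)
      case (Primal d)
      then have "d \<in> P" using e M_iff by simp
      then show ?thesis using Primal PV[of d] sub(1) unfolding dedges_def blacks_def by auto
    next
      case (Dual d)
      then have "d \<in> Q" using e M_iff by simp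
      moreover from this have "Inr (left d) \<in> blacks E V roto r"
        using bQ(2) unfolding blacks_def blk by blast
      ultimately show ?thesis using Dual sub(2) unfolding dedges_def by auto
    qed
  qed
  moreover have "\<exists>!e. e \<in> M \<and> white_end e = w" if w: "w \<in> whites E V" for w
  proof -
    obtain d where d: "d \<in> D" "w = uedge d" using w by (auto simp: whites_def)
    have "\<forall>d\<in>D. d \<in> P \<or> prod.swap d \<in> P \<or> d \<in> Q \<or> prod.swap d \<in> Q"
      using pr by (simp add: dimer_pair_def)
    then consider "Primal d \<in> M" | "Primal (prod.swap d) \<in> M" | "Dual d \<in> M" | "Dual (prod.swap d) \<in> M"
      using d(1) M_iff by blast
    then have ex: "\<exists>e. e \<in> M \<and> white_end e = w"
      by cases (metis d(2) uedge_swap white_end.simps)+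
    have sep: "\<forall>e\<in>P. prod.swap e \<notin> P \<and> e \<notin> Q \<and> prod.swap e \<notin> Q" "\<forall>e\<in>Q. prod.swap e \<notin> Q"
      using pr by (simp_all add: dimer_pair_def)
    have PP: "a = b" if "a \<in> P" "b \<in> P" "uedge a = uedge b" for a b
      using sep that unfolding uedge_eq_iff by blast
    have QQ: "a = b" if "a \<in> Q" "b \<in> Q" "uedge a = uedge b" for a b
      using sep that unfolding uedge_eq_iff by blast
    have PQ: "uedge b \<noteq> uedge a" if "a \<in> P" "b \<in> Q" for a b
      using sep that unfolding uedge_eq_iff by blast
    have "e = e'" if "e \<in> M" "white_end e = w" "e' \<in> M" "white_end e' = w" for e e'
      using that PP QQ PQ by (cases e; cases e') (simp_all add: M_iff, metis+)
    then show ?thesis using ex by blast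
  qed
  moreover have "\<exists>!e. e \<in> M \<and> black_end E V roto e = b" if b: "b \<in> blacks E V roto r" for b
  proof (cases b)
    case (Inl x)
    then have x: "x \<in> V" using b by (auto simp: blacks_def)
    then obtain d where d: "d \<in> P" "tail V d = Some x" using bP(2) by (metis image_iff imageI)
    show ?thesis
    proof (rule ex1I[of _ "Primal d"])
      show "Primal d \<in> M \<and> black_end E V roto (Primal d) = b"
        using d Inl by (auto simp: M tail_def split: if_splits)
      fix e assume e: "e \<in> M \<and> black_end E V roto e = b"
      then obtain d' where d': "e = Primal d'" "fst d' = x" using Inl by (cases e) auto
      then have "d' \<in> P" "tail V d' = Some x" using e x by (auto simp: M tail_def)
      then show "e = Primal d" using d d' bP(1) by (auto simp: inj_on_def)
    qed
  next
    case (Inr u)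
    then have u: "u \<in> left ` D - {r}" using b by (auto simp: blacks_def blk)
    then obtain d where d: "d \<in> Q" "left d = u" using bQ(2) by (metis imageE)
    show ?thesis
    proof (rule ex1I[of _ "Dual d"])
      show "Dual d \<in> M \<and> black_end E V roto (Dual d) = b"
        using d Inr by (auto simp: M)
      fix e assume e: "e \<in> M \<and> black_end E V roto e = b"
      then obtain d' where d': "e = Dual d'" "left d' = u" using Inr by (cases e) auto
      then have "d' \<in> Q" using e by (auto simp: M)
      then show "e = Dual d" using d d' bQ(1) by (auto simp: inj_on_def)
    qed
  qed
  ultimately show "M \<in> dimer_configs E V roto r" by (simp add: dimer_configs_def)
qed

text \<open>Identifying the outside points with \<open>o\<close> creates no cycle, because no step
  starts at any of them.\<close>

lemma acyclic_graph_iff: "acyclic (dart_rel (tail V) prod.swap (graph f)) \<longleftrightarrow> acyclic (graph f)"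
proof -
  define k where "k = (\<lambda>x. if x \<in> V then Some x else None)"
  let ?R = "dart_rel (tail V) prod.swap (graph f)"
  have R: "?R = (\<lambda>x. (Some x, k (f x))) ` V"
    by (auto simp: dart_rel_def tail_def k_def image_image)
  have 1: "\<exists>y. a = Some x \<longrightarrow> k y = b \<and> (x, y) \<in> (graph f)\<^sup>+" if "(a, b) \<in> ?R\<^sup>+" for a b x
    using that
  proof (induction rule: trancl_induct)
    case (base b)
    then show ?case unfolding R by auto
  next
    case (step b c)
    then obtain y where y: "a = Some x \<longrightarrow> k y = b \<and> (x, y) \<in> (graph f)\<^sup>+" by blast
    from step(2) obtain z where z: "z \<in> V" "b = Some z" "c = k (f z)" unfolding R by auto
    have "k y = b \<Longrightarrow> y = z" using z by (auto simp: k_def split: if_splits)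
    moreover have "(z, f z) \<in> graph f" using z by auto
    ultimately show ?case using y z by (intro exI[of _ "f z"]) (auto intro: trancl.trancl_into_trancl)
  qed
  have 2: "(k x, k y) \<in> ?R\<^sup>+" if "(x, y) \<in> (graph f)\<^sup>+" for x y
    using that
  proof (induction rule: trancl_induct)
    case (base y)
    then have "(k x, k y) \<in> ?R" unfolding R by (auto simp: k_def)
    then show ?case by (rule r_into_trancl)
  next
    case (step y z)
    then have "(k y, k z) \<in> ?R" unfolding R by (auto simp: k_def)
    then show ?case using step.IH by (rule trancl.trancl_into_trancl[rotated])
  qed
  show ?thesis
  proof
    assume "acyclic ?R" then show "acyclic (graph f)" using 2 unfolding acyclic_def by blast
  next
    assume acyc: "acyclic (graph f)"
    show "acyclic ?R" unfolding acyclic_def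
    proof (intro allI notI)
      fix a assume a: "(a, a) \<in> ?R\<^sup>+"
      then obtain x where x: "a = Some x" "x \<in> V" unfolding R by (auto dest: tranclD)
      then obtain y where "k y = Some x" "(x, y) \<in> (graph f)\<^sup>+" using 1[OF a, of x] by auto
      then have "(x, x) \<in> (graph f)\<^sup>+" by (auto simp: k_def split: if_splits)
      then show False using acyc unfolding acyclic_def by blast
    qed
  qed
qed

text \<open>The spanning trees of \<open>G^o\<close> directed towards \<open>o\<close>. A value
  outside \<open>V\<close> selects one of the parallel edges to \<open>o\<close>.\<close>

definition tree_maps :: "('v \<Rightarrow> 'v) set" where
  "tree_maps = {f \<in> PiE V (nbrs E). acyclic (graph f)}"

lemma graph_eqD: "\<lbrakk>f \<in> PiE V N; g \<in> PiE V N; graph f = graph g\<rbrakk> \<Longrightarrow> f = g"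
  by (rule PiE_ext[of f V N]) auto

lemma ex1_dual:
  assumes "f \<in> tree_maps" shows "\<exists>!Q. pair (graph f) Q"
proof -
  have f: "f x \<in> nbrs E x" if "x \<in> V" for x using assms that by (auto simp: tree_maps_def)
  have "graph f \<subseteq> D" using f by (auto simp: nbrs_def Go_darts_def)
  moreover have "bij_betw (tail V) (graph f) (tail V ` D - {None})"
  proof -
    have "tail V ` graph f = Some ` V"
      unfolding image_image by (rule image_cong) (auto simp: tail_def)
    then show ?thesis unfolding tails by (auto simp: bij_betw_def inj_on_def tail_def)
  qed
  moreover have "acyclic (dart_rel (tail V) prod.swap (graph f))"
    using assms acyclic_graph_iff by (simp add: tree_maps_def)
  ultimately have "\<exists>Q. pair (graph f) Q" by (rule sphere.dimer_pair_exists)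
  then show ?thesis using sphere.dimer_pair_unique by blast
qed

lemma pair_graph:
  assumes "pair P Q" shows "\<exists>f\<in>tree_maps. P = graph f"
proof -
  have PD: "P \<subseteq> D" and inj: "inj_on (tail V) P" and im: "tail V ` P = Some ` V"
    using assms by (auto simp: dimer_pair_def tails bij_betw_def)
  have ex: "\<exists>y. (x, y) \<in> P" if "x \<in> V" for x
  proof -
    have "Some x \<in> tail V ` P" using im that by blast
    then obtain d where "d \<in> P" "tail V d = Some x" by auto
    then show ?thesis by (cases d) (auto simp: tail_def split: if_splits)
  qed
  have PV: "fst d \<in> V" if "d \<in> P" for d
  proof -
    have "tail V d \<in> Some ` V" using im that by blast
    then show ?thesis by (auto simp: tail_def split: if_splits)
  qed
  define f where "f = restrict (\<lambda>x. SOME y. (x, y) \<in> P) V"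
  have fP: "(x, f x) \<in> P" if "x \<in> V" for x
    using someI_ex[OF ex[OF that]] that by (simp add: f_def)
  have gr: "P = graph f"
  proof
    show "graph f \<subseteq> P" using fP by auto
    show "P \<subseteq> graph f"
    proof
      fix d assume d: "d \<in> P"
      then have "d = (fst d, f (fst d))"
        using inj_onD[OF inj, of d "(fst d, f (fst d))"] fP[of "fst d"] PV by (simp add: tail_def)
      then show "d \<in> graph f" using PV[OF d] by (metis image_eqI)
    qed
  qed
  have "f \<in> PiE V (nbrs E)"
  proof (rule PiE_I)
    show "f x \<in> nbrs E x" if "x \<in> V" for x using fP[OF that] PD D_sub unfolding nbrs_def by blast
  qed (simp add: f_def)
  moreover have "acyclic (graph f)"
    using sphere.dimer_pair_acyclic[OF assms] acyclic_graph_iff gr by simp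
  ultimately show ?thesis using gr by (auto simp: tree_maps_def)
qed

text \<open>Dual dimers have drifted weight 1, so a configuration weighs as much as its primal
  tree.\<close>

lemma Z_dim_eq_forest_sum:
  "Z_dim E V roto r drifted = forest_sum V (nbrs E) (\<lambda>x y. c x y * lam y / lam x)"
proof -
  define dual where "dual = (\<lambda>f. THE Q. pair (graph f) Q)"
  define G where "G = (\<lambda>f. Primal ` graph f \<union> Dual ` dual f)"
  have dual: "pair (graph f) (dual f)" if "f \<in> tree_maps" for f
    unfolding dual_def using ex1_dual[OF that] by (rule theI')
  have "bij_betw G tree_maps (dimer_configs E V roto r)"
    unfolding bij_betw_def
  proof
    show "inj_on G tree_maps"
    proof (rule inj_onI)
      fix f g assume fg: "f \<in> tree_maps" "g \<in> tree_maps" "G f = G g"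
      have "graph h = {d. Primal d \<in> G h}" for h by (auto simp: G_def)
      then have "graph f = graph g" using fg(3) by simp
      then show "f = g" using graph_eqD fg by (auto simp: tree_maps_def)
    qed
    show "G ` tree_maps = dimer_configs E V roto r"
    proof
      show "G ` tree_maps \<subseteq> dimer_configs E V roto r"
        using dual unfolding G_def image_subset_iff dimer_configs_iff by blast
      show "dimer_configs E V roto r \<subseteq> G ` tree_maps"
      proof
        fix M assume "M \<in> dimer_configs E V roto r"
        then obtain P Q where pq: "pair P Q" "M = Primal ` P \<union> Dual ` Q" unfolding dimer_configs_iff by blast
        then obtain f where f: "f \<in> tree_maps" "P = graph f" using pair_graph by blast
        then have "Q = dual f" using dual pq(1) sphere.dimer_pair_unique by blast
        then show "M \<in> G ` tree_maps" using f pq(2) by (auto simp: G_def)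
      qed
    qed
  qed
  then have "Z_dim E V roto r drifted = (\<Sum>f\<in>tree_maps. \<Prod>e\<in>G f. drifted e)"
    unfolding Z_dim_def by (rule sum.reindex_bij_betw[symmetric])
  also have "\<dots> = (\<Sum>f\<in>tree_maps. \<Prod>x\<in>V. c x (f x) * lam (f x) / lam x)"
  proof (rule sum.cong)
    fix f assume f: "f \<in> tree_maps"
    have "dual f \<subseteq> D" using dual[OF f] by (auto simp: dimer_pair_def)
    then have fin: "finite (dual f)" using finite_D[OF finV] finite_subset by blast
    have "(\<Prod>e\<in>G f. drifted e) = (\<Prod>e\<in>Primal ` graph f. drifted e) * (\<Prod>e\<in>Dual ` dual f. drifted e)"
      unfolding G_def by (rule prod.union_disjoint) (use finV fin in auto)
    also have "(\<Prod>e\<in>Dual ` dual f. drifted e) = 1" by (rule prod.neutral) auto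
    also have "(\<Prod>e\<in>Primal ` graph f. drifted e) = (\<Prod>x\<in>V. drifted (Primal (x, f x)))"
      unfolding image_image by (subst prod.reindex) (auto simp: inj_on_def)
    finally show "(\<Prod>e\<in>G f. drifted e) = (\<Prod>x\<in>V. c x (f x) * lam (f x) / lam x)" by simp
  qed simp
  finally show ?thesis unfolding forest_sum_def tree_maps_def .
qed

text \<open>The roots of a forest step to a cemetery point \<open>z\<close> with weight
  \<open>m\<close>. Omitting these steps destroys no cycle, since \<open>z\<close> lies outside
  \<open>V\<close> and has no outgoing step.\<close>

lemma Z_RSF_eq_forest_sum:
  assumes z: "z \<notin> V"
  shows "Z_RSF V (induced E V) c m =
    forest_sum V (\<lambda>x. insert z (nbrs E x \<inter> V)) (\<lambda>x y. if y = z then m x else c x y)"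
proof -
  let ?N = "\<lambda>x. insert z (nbrs E x \<inter> V)"
  define S where "S = {f \<in> PiE V ?N. acyclic (graph f)}"
  define H where "H = (\<lambda>f. {(x, f x) |x. x \<in> V \<and> f x \<noteq> z})"
  have acyc: "acyclic (H f) \<longleftrightarrow> acyclic (graph f)" for f
  proof
    assume "acyclic (graph f)" moreover have "H f \<subseteq> graph f" by (auto simp: H_def)
    ultimately show "acyclic (H f)" by (rule acyclic_subset)
  next
    assume A: "acyclic (H f)"
    have step: "b \<noteq> z \<longrightarrow> (a, b) \<in> (H f)\<^sup>+" if "(a, b) \<in> (graph f)\<^sup>+" for a b
      using that
    proof (induction rule: trancl_induct)
      case (base b) then show ?case by (auto simp: H_def)
    next
      case (step b c)
      then have "b \<in> V" by auto
      then have "b \<noteq> z" using z by auto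
      moreover have "c \<noteq> z \<Longrightarrow> (b, c) \<in> H f" using step.hyps by (auto simp: H_def)
      ultimately show ?case using step.IH by (auto intro: trancl.trancl_into_trancl)
    qed
    show "acyclic (graph f)" unfolding acyclic_def
    proof (intro allI notI)
      fix a assume a: "(a, a) \<in> (graph f)\<^sup>+"
      then have "a \<in> V" by (auto dest: tranclD)
      then show False using A step[OF a] z unfolding acyclic_def by auto
    qed
  qed
  have "bij_betw H S (rooted_forests (induced E V))"
    unfolding bij_betw_def
  proof
    show "inj_on H S"
    proof (rule inj_onI)
      fix f g assume fg: "f \<in> S" "g \<in> S" "H f = H g"
      show "f = g"
      proof (rule PiE_ext[of f V ?N])
        fix x assume "x \<in> V"
        show "f x = g x"
        proof (rule ccontr)
          assume ne: "f x \<noteq> g x"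
          then have "(x, f x) \<in> H f \<or> (x, g x) \<in> H g" using \<open>x \<in> V\<close> by (auto simp: H_def)
          then have "(x, f x) \<in> H g \<or> (x, g x) \<in> H f" using fg(3) by auto
          then show False using ne by (auto simp: H_def)
        qed
      qed (use fg S_def in auto)
    qed
    show "H ` S = rooted_forests (induced E V)"
    proof
      show "H ` S \<subseteq> rooted_forests (induced E V)"
      proof
        fix F assume "F \<in> H ` S"
        then obtain f where f: "f \<in> PiE V ?N" "acyclic (graph f)" "F = H f" by (auto simp: S_def)
        have "F \<subseteq> induced E V"
        proof
          fix d assume "d \<in> F"
          then obtain x where x: "d = (x, f x)" "x \<in> V" "f x \<noteq> z" using f(3) by (auto simp: H_def)
          then have "f x \<in> ?N x" using f(1) by auto
          then show "d \<in> induced E V" using x by (auto simp: induced_def nbrs_def)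
        qed
        moreover have "single_valued F" by (auto simp: f(3) H_def single_valued_def)
        ultimately show "F \<in> rooted_forests (induced E V)"
          using acyc f by (simp add: rooted_forests_def)
      qed
      show "rooted_forests (induced E V) \<subseteq> H ` S"
      proof
        fix F assume "F \<in> rooted_forests (induced E V)"
        then have F: "F \<subseteq> induced E V" "acyclic F" "single_valued F" by (auto simp: rooted_forests_def)
        define f where "f = restrict (\<lambda>x. if x \<in> Domain F then SOME y. (x, y) \<in> F else z) V"
        have some: "(SOME y. (x, y) \<in> F) = y" if "(x, y) \<in> F" for x y
          using F(3) that by (auto simp: single_valued_def)
        have fy: "f x = y" if "(x, y) \<in> F" for x y
          using that some[OF that] F(1) by (auto simp: f_def induced_def)
        have fz: "f x = z" if "x \<in> V" "x \<notin> Domain F" for x using that by (simp add: f_def)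
        have HF: "H f = F"
        proof
          show "H f \<subseteq> F" using fz fy by (auto simp: H_def) 
          show "F \<subseteq> H f"
          proof
            fix d assume d: "d \<in> F"
            then have "f (fst d) = snd d" "fst d \<in> V" "snd d \<in> V"
              using fy[of "fst d" "snd d"] F(1) by (auto simp: induced_def)
            then show "d \<in> H f" using z unfolding H_def by (cases d) auto
          qed
        qed
        have "f x \<in> ?N x" if "x \<in> V" for x
        proof (cases "x \<in> Domain F")
          case True
          then obtain y where "(x, y) \<in> F" by auto
          then show ?thesis using fy F(1) by (auto simp: induced_def nbrs_def)
        qed (use fz that in simp)
        then have "f \<in> PiE V ?N" by (auto simp: f_def)
        moreover have "acyclic (graph f)" using acyc HF F(2) by metis
        ultimately show "F \<in> H ` S" using HF by (auto simp: S_def)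
      qed
    qed
  qed
  then have "Z_RSF V (induced E V) c m =
      (\<Sum>f\<in>S. (\<Prod>d\<in>H f. c (fst d) (snd d)) * (\<Prod>x\<in>V - Domain (H f). m x))"
    unfolding Z_RSF_def by (rule sum.reindex_bij_betw[symmetric])
  also have "\<dots> = (\<Sum>f\<in>S. \<Prod>x\<in>V. if f x = z then m x else c x (f x))"
  proof (rule sum.cong)
    fix f assume "f \<in> S"
    let ?w = "\<lambda>x. if f x = z then m x else c x (f x)"
    let ?A = "{x \<in> V. f x \<noteq> z}"
    have H: "H f = (\<lambda>x. (x, f x)) ` ?A" "Domain (H f) = ?A" by (auto simp: H_def)
    have "(\<Prod>d\<in>H f. c (fst d) (snd d)) = (\<Prod>x\<in>?A. ?w x)"
      unfolding H(1) by (subst prod.reindex) (auto simp: inj_on_def intro: prod.cong)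
    moreover have "(\<Prod>x\<in>V - Domain (H f). m x) = (\<Prod>x\<in>V - ?A. ?w x)"
      unfolding H(2) by (rule prod.cong) auto
    ultimately show "(\<Prod>d\<in>H f. c (fst d) (snd d)) * (\<Prod>x\<in>V - Domain (H f). m x) = (\<Prod>x\<in>V. ?w x)"
      using prod.subset_diff[of ?A V ?w] finV by (simp add: mult.commute)
  qed simp
  finally show ?thesis unfolding forest_sum_def S_def .
qed

text \<open>
  By massive harmonicity the drifted Laplacian with a root at \<open>o\<close> is the massive Laplacian
  conjugated by \<open>\<lambda>\<close>.
\<close>

lemma Z_RSF_eq_Z_dim: "Z_RSF V (induced E V) c (mass_G E V c mI) = Z_dim E V roto r drifted"
proof -
  obtain z0 where z0: "z0 \<in> VI" "z0 \<notin> V" using V_proper by auto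
  have "forest_sum V (\<lambda>x. insert z0 (nbrs E x \<inter> V)) (\<lambda>x y. if y = z0 then mass_G E V c mI x else c x y) =
      forest_sum V (nbrs E) (\<lambda>x y. c x y * lam y / lam x)"
  proof (rule forest_sum_conjugate[where h = lam])
    show "lam x \<noteq> 0" if "x \<in> V" for x using lam_pos V_sub that by force
    fix x z assume x: "x \<in> V" and z: "z \<in> V"
    have l: "lam x > 0" using lam_pos V_sub x by auto
    have irr: "x \<notin> nbrs E x" using E_irrefl by (force simp: nbrs_def)
    have fin: "finite (nbrs E x)" by (rule finite_nbrs[OF x])
    have "z \<noteq> z0" using z z0 by auto
    have on: "z0 \<notin> nbrs E x \<inter> V" using z0 by auto
    let ?w = "\<lambda>y. if y = z0 then mass_G E V c mI x else c x y"
    have w: "?w y = c x y" if "y \<in> nbrs E x \<inter> V" for y using that z0 by auto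
    show "(\<Sum>y\<in>nbrs E x. c x y * lam y / lam x * (of_bool (x = z) - of_bool (y = z))) =
      (\<Sum>y\<in>insert z0 (nbrs E x \<inter> V). ?w y * (of_bool (x = z) - of_bool (y = z))) * lam z / lam x"
    proof (cases "z = x")
      case True
      have "(\<Sum>y\<in>nbrs E x. c x y * lam y / lam x * (of_bool (x = z) - of_bool (y = z))) =
          (\<Sum>y\<in>nbrs E x. c x y * lam y / lam x)"
        using True irr by (intro sum.cong) auto
      also have "\<dots> = mI x + (\<Sum>y\<in>nbrs E x. c x y)" by (rule harmonic_sum[OF x])
      \<comment> \<open>The conductances to outside neighbours are the extra mass in
        \<open>mass_G\<close>, so on the diagonal the single step to \<open>z0\<close> accounts for
        all edges to \<open>o\<close>.\<close>
      also have "(\<Sum>y\<in>nbrs E x. c x y) = (\<Sum>y\<in>nbrs E x \<inter> V. c x y) + (\<Sum>y\<in>nbrs E x - V. c x y)"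
        by (rule sum.Int_Diff[OF fin])
      also have "mI x + \<dots> = mass_G E V c mI x + (\<Sum>y\<in>nbrs E x \<inter> V. c x y)"
        by (simp add: mass_G_def)
      also have "\<dots> = (\<Sum>y\<in>insert z0 (nbrs E x \<inter> V). ?w y * (of_bool (x = z) - of_bool (y = z)))"
      proof -
        have "(\<Sum>y\<in>nbrs E x \<inter> V. ?w y * (of_bool (x = z) - of_bool (y = z))) = (\<Sum>y\<in>nbrs E x \<inter> V. c x y)"
          using True irr w by (intro sum.cong) auto
        then show ?thesis using True fin on z0 x by (subst sum.insert) auto
      qed
      finally show ?thesis using True l by simp
    next
      case False
      have "(\<Sum>y\<in>nbrs E x. c x y * lam y / lam x * (of_bool (x = z) - of_bool (y = z))) =
          (\<Sum>y\<in>nbrs E x. if y = z then - (c x z * lam z / lam x) else 0)"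
        using False by (intro sum.cong) auto
      also have "\<dots> = (if z \<in> nbrs E x then - (c x z * lam z / lam x) else 0)"
        using fin by (simp add: sum.delta)
      \<comment> \<open>Off the diagonal the drift quotient of the step from \<open>x\<close> to
        \<open>z\<close> is the conjugating factor itself.\<close>
      also have "\<dots> = (if z \<in> nbrs E x then - c x z else 0) * lam z / lam x" by simp
      also have "(if z \<in> nbrs E x then - c x z else 0) =
          (\<Sum>y\<in>insert z0 (nbrs E x \<inter> V). if y = z then - c x z else 0)"
        using fin z \<open>z \<noteq> z0\<close> by (simp add: sum.delta)
      also have "\<dots> = (\<Sum>y\<in>insert z0 (nbrs E x \<inter> V). ?w y * (of_bool (x = z) - of_bool (y = z)))"
        using False z z0 by (intro sum.cong) auto
      finally show ?thesis .
    qed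
  qed (use finV finite_nbrs in auto)
  then show ?thesis using Z_RSF_eq_forest_sum[OF z0(2)] Z_dim_eq_forest_sum by simp
qed

end

theorem theorem1p2:
  fixes VI V :: "'v set" and E :: "'v dart set" and rot roto :: "'v dart \<Rightarrow> 'v dart"
    and c :: "'v \<Rightarrow> 'v \<Rightarrow> real" and mI lam :: "'v \<Rightarrow> real" and lams :: "'v face \<Rightarrow> real"
    and r :: "'v face" and ori :: "'v set \<Rightarrow> 'v dart"
    and Kd Kk :: "'v set \<Rightarrow> 'v + 'v face \<Rightarrow> complex"
  assumes plane: "plane_graph VI E rot"
    and conductances: "\<forall>(x, y) \<in> E. c x y > 0 \<and> c x y = c y x"
    and masses: "\<forall>x \<in> VI. mI x \<ge> 0"
    and cases: "infinite_case VI V \<or> finite_case VI E rot V"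
    and Go: "Go_rotation E rot V roto"
    and root: "finite V \<longrightarrow> r \<in> Vstar E V roto \<and> incident_o V r"
    and orientation: "\<forall>w \<in> whites E V. ori w \<in> Go_darts E V \<and> uedge (ori w) = w"
    and lam_pos: "\<forall>x \<in> VI. lam x > 0"
    and lam_harmonic: "\<forall>x \<in> V. massive_laplacian E c mI lam x = 0"
    and lams_pos: "\<forall>u \<in> Vstar E V roto. lams u > 0"
  defines "Kd \<equiv> Kasteleyn E V roto r ori (drifted_weight c lam)"
    and "Kk \<equiv> Kasteleyn E V roto r ori (killed_weight E V roto c lam lams)"
  shows
    "(finite V \<longrightarrow>
        Z_RSF V (induced E V) c (mass_G E V c mI) = Z_dim E V roto r (drifted_weight c lam)) \<and>
     (\<exists>(\<Phi> :: 'v set \<Rightarrow> real) (\<Psi> :: 'v + 'v face \<Rightarrow> real).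
        (\<forall>w \<in> whites E V. \<Phi> w > 0) \<and> (\<forall>b \<in> blacks E V roto r. \<Psi> b > 0) \<and>
        (\<forall>w \<in> whites E V. \<forall>b \<in> blacks E V roto r.
           Kk w b = complex_of_real (\<Phi> w) * Kd w b * complex_of_real (\<Psi> b))) \<and>
     (\<exists>Dstar :: 'v face \<Rightarrow> 'v face \<Rightarrow> complex.
        \<forall>b \<in> blacks E V roto r. \<forall>b' \<in> blacks E V roto r.
          gram (whites E V) Kk b b' =
            block_diag (\<lambda>x y. complex_of_real (laplacian_matrix E c mI x y)) Dstar b b')"
proof -
  interpret weighted_Go_map VI V E rot roto c mI lam lams r ori
    using plane cases Go conductances orientation lam_pos lam_harmonic lams_pos
    by (simp add: weighted_Go_map_def weighted_Go_map_axioms_def Go_map_def)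
  have "Z_RSF V (induced E V) c (mass_G E V c mI) = Z_dim E V roto r drifted" if "finite V"
  proof -
    interpret finite_Go_map VI V E rot roto c mI lam lams r ori
      using root that by unfold_locales auto
    show ?thesis by (rule Z_RSF_eq_Z_dim)
  qed
  moreover have "Kk w b = complex_of_real (edge_gauge w) * Kd w b * complex_of_real (vertex_gauge b)" for w b
    unfolding Kk_def Kd_def by (rule gauge_equivalent)
  ultimately show ?thesis
    using edge_gauge_pos vertex_gauge_pos gram_block_diag unfolding Kk_def by blast
qed

end
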